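(* Let $\mathcal{T}$ be a triangulated category and consider maps $X\xrightarrow{\varphi}Y\xrightarrow{\psi}Z$, $X'\xrightarrow{\varphi'}Y'\xrightarrow{\psi'}Z'$, $f\colon X\to X'$, $g\colon Y\to Y'$, $h\colon Z\to Z'$ in $\mathcal{T}$ with $g\varphi=\varphi'f$ and $h\psi=\psi'g$. If the left square $(\varphi,f,g,\varphi')$ and the right square $(\psi,g,h,\psi')$ are homotopy cartesian, then so is their pasting, the rectangle $(\psi\varphi,f,h,\psi'\varphi')$. Moreover, given differentials $\partial_L\colon Y'\to\Sigma X$ and $\partial_R\colon Z'\to\Sigma Y$ of the left square and right square respectively, there exists a differential $\partial_P\colon Z'\to\Sigma X$ for the pasted rectangle satisfying $$(\Sigma\varphi)\,\partial_P=\partial_R\quad\text{and}\quad \partial_P\,\psi'=\partial_L.$$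
   Context: $\mathcal{T}$ is a triangulated category with self-equivalence $\Sigma$; "exact triangle" means distinguished triangle. A commutative square with top map $p\colon P\to Q$, left map $a\colon P\to P'$, right map $b\colon Q\to Q'$ and bottom map $p'\colon P'\to Q'$ (so $bp=p'a$), written $(p,a,b,p')$, is homotopy cartesian if there is an exact triangle $$P\xrightarrow{\begin{bmatrix} a \\ p \end{bmatrix}}P'\oplus Q\xrightarrow{\begin{bmatrix}p'&-b\end{bmatrix}}Q'\xrightarrow{\ \partial\ }\Sigma P$$ for some map $\partial\colon Q'\to\Sigma P$; any such $\partial$ is called a differential of the square. The horizontal and vertical directions play asymmetric roles in this sign convention. *)

theory Defs
  imports "HOL-Algebra.Group"
begin

record ('o, 'm) category =
  Ob :: "'o set"
  Ar :: "'m set"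
  src :: "'m \<Rightarrow> 'o"
  tgt :: "'m \<Rightarrow> 'o"
  ident :: "'o \<Rightarrow> 'm" ("\<I>\<index>")
  compose :: "'m \<Rightarrow> 'm \<Rightarrow> 'm" (infixr "\<cdot>\<index>" 70)

text \<open>Composition is written in applicative order: \<open>g \<cdot> f\<close> is \<open>f\<close> followed by \<open>g\<close>. The
  operations are constrained only on objects and on composable (or parallel) morphisms.\<close>

definition Hom :: "('o, 'm, 'z) category_scheme \<Rightarrow> 'o \<Rightarrow> 'o \<Rightarrow> 'm set" where
  "Hom C X Y = {f \<in> Ar C. src C f = X \<and> tgt C f = Y}"

locale category =
  fixes C :: "('o, 'm, 'z) category_scheme" (structure)
  assumes src_closed: "f \<in> Ar C \<Longrightarrow> src C f \<in> Ob C"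
    and tgt_closed: "f \<in> Ar C \<Longrightarrow> tgt C f \<in> Ob C"
    and ident_closed: "X \<in> Ob C \<Longrightarrow> \<I> X \<in> Hom C X X"
    and compose_closed: "f \<in> Hom C X Y \<Longrightarrow> g \<in> Hom C Y Z \<Longrightarrow> g \<cdot> f \<in> Hom C X Z"
    and ident_left: "f \<in> Hom C X Y \<Longrightarrow> \<I> Y \<cdot> f = f"
    and ident_right: "f \<in> Hom C X Y \<Longrightarrow> f \<cdot> \<I> X = f"
    and compose_assoc: "f \<in> Hom C W X \<Longrightarrow> g \<in> Hom C X Y \<Longrightarrow> h \<in> Hom C Y Z \<Longrightarrow>
      (h \<cdot> g) \<cdot> f = h \<cdot> (g \<cdot> f)"

definition is_iso :: "('o, 'm, 'z) category_scheme \<Rightarrow> 'm \<Rightarrow> bool" where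
  "is_iso C f \<longleftrightarrow> f \<in> Ar C \<and>
    (\<exists>g \<in> Hom C (tgt C f) (src C f).
      g \<cdot>\<^bsub>C\<^esub> f = \<I>\<^bsub>C\<^esub> (src C f) \<and> f \<cdot>\<^bsub>C\<^esub> g = \<I>\<^bsub>C\<^esub> (tgt C f))"

definition zero_object :: "('o, 'm, 'z) category_scheme \<Rightarrow> 'o \<Rightarrow> bool" where
  "zero_object C Z \<longleftrightarrow> Z \<in> Ob C \<and>
    (\<forall>X \<in> Ob C. (\<exists>!f. f \<in> Hom C X Z) \<and> (\<exists>!f. f \<in> Hom C Z X))"

definition endofunctor ::
  "('o, 'm, 'z) category_scheme \<Rightarrow> ('o \<Rightarrow> 'o) \<Rightarrow> ('m \<Rightarrow> 'm) \<Rightarrow> bool" where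
  "endofunctor C Fo Fm \<longleftrightarrow>
    (\<forall>X \<in> Ob C. Fo X \<in> Ob C) \<and>
    (\<forall>X Y. \<forall>f \<in> Hom C X Y. Fm f \<in> Hom C (Fo X) (Fo Y)) \<and>
    (\<forall>X \<in> Ob C. Fm (\<I>\<^bsub>C\<^esub> X) = \<I>\<^bsub>C\<^esub> (Fo X)) \<and>
    (\<forall>X Y Z. \<forall>f \<in> Hom C X Y. \<forall>g \<in> Hom C Y Z. Fm (g \<cdot>\<^bsub>C\<^esub> f) = Fm g \<cdot>\<^bsub>C\<^esub> Fm f)"

definition natural_iso ::
  "('o, 'm, 'z) category_scheme \<Rightarrow> ('o \<Rightarrow> 'o) \<Rightarrow> ('m \<Rightarrow> 'm) \<Rightarrow> ('o \<Rightarrow> 'o) \<Rightarrow> ('m \<Rightarrow> 'm) \<Rightarrow>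
    ('o \<Rightarrow> 'm) \<Rightarrow> bool" where
  "natural_iso C Fo Fm Go Gm \<eta> \<longleftrightarrow>
    (\<forall>X \<in> Ob C. \<eta> X \<in> Hom C (Fo X) (Go X) \<and> is_iso C (\<eta> X)) \<and>
    (\<forall>X Y. \<forall>f \<in> Hom C X Y. \<eta> Y \<cdot>\<^bsub>C\<^esub> Fm f = Gm f \<cdot>\<^bsub>C\<^esub> \<eta> X)"

definition self_equivalence ::
  "('o, 'm, 'z) category_scheme \<Rightarrow> ('o \<Rightarrow> 'o) \<Rightarrow> ('m \<Rightarrow> 'm) \<Rightarrow> bool" where
  "self_equivalence C Fo Fm \<longleftrightarrow> endofunctor C Fo Fm \<and>
    (\<exists>Go Gm \<eta> \<epsilon>. endofunctor C Go Gm \<and>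
      natural_iso C id id (Go \<circ> Fo) (Gm \<circ> Fm) \<eta> \<and>
      natural_iso C (Fo \<circ> Go) (Fm \<circ> Gm) id id \<epsilon>)"

record ('o, 'm) preadditive = "('o, 'm) category" +
  plus_mor :: "'m \<Rightarrow> 'm \<Rightarrow> 'm" (infixl "\<oplus>\<index>" 65)
  zero_mor :: "'o \<Rightarrow> 'o \<Rightarrow> 'm" ("\<O>\<index>")

definition Hom_group :: "('o, 'm, 'z) preadditive_scheme \<Rightarrow> 'o \<Rightarrow> 'o \<Rightarrow> 'm monoid" where
  "Hom_group C X Y = \<lparr>carrier = Hom C X Y, mult = plus_mor C, one = zero_mor C X Y\<rparr>"

definition neg_mor :: "('o, 'm, 'z) preadditive_scheme \<Rightarrow> 'm \<Rightarrow> 'm" ("\<ominus>\<index> _" [81] 80) where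
  "neg_mor C f = inv\<^bsub>Hom_group C (src C f) (tgt C f)\<^esub> f"

definition biproduct ::
  "('o, 'm, 'z) preadditive_scheme \<Rightarrow> 'o \<Rightarrow> 'o \<Rightarrow> 'o \<Rightarrow> 'm \<Rightarrow> 'm \<Rightarrow> 'm \<Rightarrow> 'm \<Rightarrow> bool" where
  "biproduct C X Y B \<iota>\<^sub>1 \<iota>\<^sub>2 \<pi>\<^sub>1 \<pi>\<^sub>2 \<longleftrightarrow>
    \<iota>\<^sub>1 \<in> Hom C X B \<and> \<iota>\<^sub>2 \<in> Hom C Y B \<and> \<pi>\<^sub>1 \<in> Hom C B X \<and> \<pi>\<^sub>2 \<in> Hom C B Y \<and>
    \<pi>\<^sub>1 \<cdot>\<^bsub>C\<^esub> \<iota>\<^sub>1 = \<I>\<^bsub>C\<^esub> X \<and> \<pi>\<^sub>2 \<cdot>\<^bsub>C\<^esub> \<iota>\<^sub>2 = \<I>\<^bsub>C\<^esub> Y \<and>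
    \<pi>\<^sub>1 \<cdot>\<^bsub>C\<^esub> \<iota>\<^sub>2 = \<O>\<^bsub>C\<^esub> Y X \<and> \<pi>\<^sub>2 \<cdot>\<^bsub>C\<^esub> \<iota>\<^sub>1 = \<O>\<^bsub>C\<^esub> X Y \<and>
    (\<iota>\<^sub>1 \<cdot>\<^bsub>C\<^esub> \<pi>\<^sub>1) \<oplus>\<^bsub>C\<^esub> (\<iota>\<^sub>2 \<cdot>\<^bsub>C\<^esub> \<pi>\<^sub>2) = \<I>\<^bsub>C\<^esub> B"

locale additive_category = category C
  for C :: "('o, 'm, 'z) preadditive_scheme" (structure) +
  assumes Hom_comm_group: "X \<in> Ob C \<Longrightarrow> Y \<in> Ob C \<Longrightarrow> comm_group (Hom_group C X Y)"
    and compose_plus_left: "f \<in> Hom C X Y \<Longrightarrow> g \<in> Hom C Y Z \<Longrightarrow> g' \<in> Hom C Y Z \<Longrightarrow>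
      (g \<oplus> g') \<cdot> f = (g \<cdot> f) \<oplus> (g' \<cdot> f)"
    and compose_plus_right: "f \<in> Hom C X Y \<Longrightarrow> f' \<in> Hom C X Y \<Longrightarrow> g \<in> Hom C Y Z \<Longrightarrow>
      g \<cdot> (f \<oplus> f') = (g \<cdot> f) \<oplus> (g \<cdot> f')"
    and zero_object_exists: "\<exists>Z. zero_object C Z"
    and biproduct_exists: "X \<in> Ob C \<Longrightarrow> Y \<in> Ob C \<Longrightarrow>
      \<exists>B \<iota>\<^sub>1 \<iota>\<^sub>2 \<pi>\<^sub>1 \<pi>\<^sub>2. biproduct C X Y B \<iota>\<^sub>1 \<iota>\<^sub>2 \<pi>\<^sub>1 \<pi>\<^sub>2"

text \<open>\<open>exact T f g h\<close> says that \<open>f\<close>, \<open>g\<close>, \<open>h\<close> form an exact (distinguished) triangle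
  \<open>X \<rightarrow> Y \<rightarrow> Z \<rightarrow> \<Sigma> X\<close>. \<open>susp_ob\<close> and \<open>susp\<close> are the object and morphism parts of \<open>\<Sigma>\<close>.\<close>

record ('o, 'm) triangulated = "('o, 'm) preadditive" +
  susp_ob :: "'o \<Rightarrow> 'o"
  susp :: "'m \<Rightarrow> 'm"
  exact :: "'m \<Rightarrow> 'm \<Rightarrow> 'm \<Rightarrow> bool"

text \<open>A candidate triangle only has the right sources and targets; its consecutive composites are
  not required to vanish (for exact triangles this follows from the axioms).\<close>

definition candidate_triangle ::
  "('o, 'm, 'z) triangulated_scheme \<Rightarrow> 'm \<Rightarrow> 'm \<Rightarrow> 'm \<Rightarrow> bool" where
  "candidate_triangle T f g h \<longleftrightarrow>
    (\<exists>X Y Z. f \<in> Hom T X Y \<and> g \<in> Hom T Y Z \<and> h \<in> Hom T Z (susp_ob T X))"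

definition triangle_morphism ::
  "('o, 'm, 'z) triangulated_scheme \<Rightarrow> 'm \<Rightarrow> 'm \<Rightarrow> 'm \<Rightarrow> 'm \<Rightarrow> 'm \<Rightarrow> 'm \<Rightarrow> 'm \<Rightarrow> 'm \<Rightarrow> 'm \<Rightarrow> bool"
  where
  "triangle_morphism T f g h f' g' h' u v w \<longleftrightarrow>
    candidate_triangle T f g h \<and> candidate_triangle T f' g' h' \<and>
    u \<in> Hom T (src T f) (src T f') \<and> v \<in> Hom T (src T g) (src T g') \<and>
    w \<in> Hom T (src T h) (src T h') \<and>
    v \<cdot>\<^bsub>T\<^esub> f = f' \<cdot>\<^bsub>T\<^esub> u \<and> w \<cdot>\<^bsub>T\<^esub> g = g' \<cdot>\<^bsub>T\<^esub> v \<and> susp T u \<cdot>\<^bsub>T\<^esub> h = h' \<cdot>\<^bsub>T\<^esub> w"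

locale triangulated_category = additive_category T
  for T :: "('o, 'm, 'z) triangulated_scheme" (structure) +
  assumes susp_self_equivalence: "self_equivalence T (susp_ob T) (susp T)"
    and susp_plus: "f \<in> Hom T X Y \<Longrightarrow> f' \<in> Hom T X Y \<Longrightarrow>
      susp T (f \<oplus> f') = susp T f \<oplus> susp T f'"
    and exact_candidate: "exact T f g h \<Longrightarrow> candidate_triangle T f g h"
    and TR1_iso: "exact T f g h \<Longrightarrow> triangle_morphism T f g h f' g' h' u v w \<Longrightarrow>
      is_iso T u \<Longrightarrow> is_iso T v \<Longrightarrow> is_iso T w \<Longrightarrow> exact T f' g' h'"
    and TR1_ident: "X \<in> Ob T \<Longrightarrow> zero_object T N \<Longrightarrow>
      exact T (\<I> X) (\<O> X N) (\<O> N (susp_ob T X))"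
    and TR1_complete: "f \<in> Ar T \<Longrightarrow> \<exists>g h. exact T f g h"
    and TR2_rotate: "candidate_triangle T f g h \<Longrightarrow>
      exact T f g h \<longleftrightarrow> exact T g h (\<ominus> (susp T f))"
    and TR3_fill: "exact T f g h \<Longrightarrow> exact T f' g' h' \<Longrightarrow>
      u \<in> Hom T (src T f) (src T f') \<Longrightarrow> v \<in> Hom T (tgt T f) (tgt T f') \<Longrightarrow>
      v \<cdot> f = f' \<cdot> u \<Longrightarrow> \<exists>w. triangle_morphism T f g h f' g' h' u v w"
    and TR4_octahedral: "f \<in> Hom T X Y \<Longrightarrow> g \<in> Hom T Y Z \<Longrightarrow>
      exact T f u u' \<Longrightarrow> exact T g v v' \<Longrightarrow> exact T (g \<cdot> f) w w' \<Longrightarrow>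
      \<exists>s \<in> Hom T (tgt T u) (tgt T w). \<exists>t \<in> Hom T (tgt T w) (tgt T v).
        exact T s t (susp T u \<cdot> v') \<and>
        s \<cdot> u = w \<cdot> g \<and> w' \<cdot> s = u' \<and> t \<cdot> w = v \<and> v' \<cdot> t = susp T f \<cdot> w'"

text \<open>Squares \<open>(p, a, b, p')\<close> with top \<open>p : P \<rightarrow> Q\<close>, left \<open>a : P \<rightarrow> P'\<close>, right \<open>b : Q \<rightarrow> Q'\<close> and
  bottom \<open>p' : P' \<rightarrow> Q'\<close>.\<close>

definition commutative_square ::
  "('o, 'm, 'z) category_scheme \<Rightarrow> 'm \<Rightarrow> 'm \<Rightarrow> 'm \<Rightarrow> 'm \<Rightarrow> bool" where
  "commutative_square C p a b p' \<longleftrightarrow>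
    (\<exists>P Q P' Q'. p \<in> Hom C P Q \<and> a \<in> Hom C P P' \<and> b \<in> Hom C Q Q' \<and> p' \<in> Hom C P' Q') \<and>
    b \<cdot>\<^bsub>C\<^esub> p = p' \<cdot>\<^bsub>C\<^esub> a"

text \<open>The column \<open>[a; p]\<close> into \<open>P' \<oplus> Q\<close> is \<open>\<iota>\<^sub>1 a + \<iota>\<^sub>2 p\<close> and the row \<open>[p', -b]\<close> out of it is
  \<open>p' \<pi>\<^sub>1 + (-b) \<pi>\<^sub>2\<close>. Since exact triangles are closed under isomorphism, the choice of the
  biproduct is immaterial.\<close>

definition differential ::
  "('o, 'm, 'z) triangulated_scheme \<Rightarrow> 'm \<Rightarrow> 'm \<Rightarrow> 'm \<Rightarrow> 'm \<Rightarrow> 'm \<Rightarrow> bool" where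
  "differential T p a b p' d \<longleftrightarrow> commutative_square T p a b p' \<and>
    d \<in> Hom T (tgt T p') (susp_ob T (src T p)) \<and>
    (\<exists>B \<iota>\<^sub>1 \<iota>\<^sub>2 \<pi>\<^sub>1 \<pi>\<^sub>2. biproduct T (tgt T a) (tgt T p) B \<iota>\<^sub>1 \<iota>\<^sub>2 \<pi>\<^sub>1 \<pi>\<^sub>2 \<and>
      exact T ((\<iota>\<^sub>1 \<cdot>\<^bsub>T\<^esub> a) \<oplus>\<^bsub>T\<^esub> (\<iota>\<^sub>2 \<cdot>\<^bsub>T\<^esub> p))
        ((p' \<cdot>\<^bsub>T\<^esub> \<pi>\<^sub>1) \<oplus>\<^bsub>T\<^esub> ((\<ominus>\<^bsub>T\<^esub> b) \<cdot>\<^bsub>T\<^esub> \<pi>\<^sub>2)) d)"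

definition homotopy_cartesian ::
  "('o, 'm, 'z) triangulated_scheme \<Rightarrow> 'm \<Rightarrow> 'm \<Rightarrow> 'm \<Rightarrow> 'm \<Rightarrow> bool" where
  "homotopy_cartesian T p a b p' \<longleftrightarrow> (\<exists>d. differential T p a b p' d)"

end

theory Submission imports Defs begin

text \<open>The proof is one application of the octahedral axiom, to \<open>A = [f; \<phi>] : X \<rightarrow> X' \<oplus> Y\<close> followed by
  \<open>B : X' \<oplus> Y \<rightarrow> X' \<oplus> Z \<oplus> Y'\<close>, the map \<open>1\<^bsub>X'\<^esub> \<oplus> [g; \<psi>]\<close> twisted by an automorphism of its target so
  that the composite is \<open>[f; \<psi> \<phi>; 0]\<close>. The cones of \<open>A\<close>, \<open>B\<close> and \<open>B A\<close> are \<open>Y'\<close>, \<open>Z'\<close> and \<open>W \<oplus> Y'\<close>,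
  where \<open>W\<close> is the cone of \<open>[f; \<psi> \<phi>]\<close>. In the resulting triangle \<open>Y' \<rightarrow> W \<oplus> Y' \<rightarrow> Z'\<close> the component
  \<open>Y' \<rightarrow> Y'\<close> is \<open>-1\<close> up to a correction that factors through \<open>\<delta>\<^sub>L\<close>, so the triangle splits and
  identifies \<open>W\<close> with \<open>Z'\<close>; the octahedral relations become the two equations for \<open>\<delta>\<^sub>P\<close>.\<close>

section \<open>Composition, isomorphisms and equivalences of categories\<close>

lemma mem_Hom: "f \<in> Hom C X Y \<longleftrightarrow> f \<in> Ar C \<and> src C f = X \<and> tgt C f = Y"
  by (auto simp: Hom_def)

context category begin

declare mem_Hom [simp] src_closed [simp] tgt_closed [simp]

lemma ident_simps [simp]:
  assumes "X \<in> Ob C"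
  shows "\<I> X \<in> Ar C" "src C (\<I> X) = X" "tgt C (\<I> X) = X"
  using ident_closed[OF assms] by auto

lemma comp_simps [simp]:
  assumes "f \<in> Ar C" "g \<in> Ar C" "src C g = tgt C f"
  shows "g \<cdot> f \<in> Ar C" "src C (g \<cdot> f) = src C f" "tgt C (g \<cdot> f) = tgt C g"
  using compose_closed[of f "src C f" "tgt C f" g "tgt C g"] assms by auto

lemma comp_ident_left [simp]: "f \<in> Ar C \<Longrightarrow> tgt C f = Y \<Longrightarrow> \<I> Y \<cdot> f = f"
  using ident_left by auto

lemma comp_ident_right [simp]: "f \<in> Ar C \<Longrightarrow> src C f = X \<Longrightarrow> f \<cdot> \<I> X = f"
  using ident_right by auto

lemma comp_assoc [simp]:
  "f \<in> Ar C \<Longrightarrow> g \<in> Ar C \<Longrightarrow> h \<in> Ar C \<Longrightarrow> src C g = tgt C f \<Longrightarrow> src C h = tgt C g \<Longrightarrow>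
    (h \<cdot> g) \<cdot> f = h \<cdot> (g \<cdot> f)"
  using compose_assoc by auto

text \<open>Composites are normalized to right-nested form, in which \<open>h \<cdot> g\<close> is
  no longer a subterm. This turns an equation for it into a rewrite rule for that form.\<close>

lemma comp_eq_assoc:
  "h \<cdot> g = k \<Longrightarrow> f \<in> Ar C \<Longrightarrow> g \<in> Ar C \<Longrightarrow> h \<in> Ar C \<Longrightarrow> src C g = tgt C f \<Longrightarrow>
    src C h = tgt C g \<Longrightarrow> h \<cdot> (g \<cdot> f) = k \<cdot> f"
  using comp_assoc by metis

lemma is_isoI:
  assumes "f \<in> Hom C X Y" "g \<in> Hom C Y X" "g \<cdot> f = \<I> X" "f \<cdot> g = \<I> Y"
  shows "is_iso C f"
  using assms by (auto simp: is_iso_def intro!: bexI[of _ g])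

lemma is_isoE:
  assumes "is_iso C f" "f \<in> Hom C X Y"
  obtains g where "g \<in> Hom C Y X" "g \<cdot> f = \<I> X" "f \<cdot> g = \<I> Y"
  using assms by (auto simp: is_iso_def)

lemma is_iso_ident: "X \<in> Ob C \<Longrightarrow> is_iso C (\<I> X)"
  by (rule is_isoI[of _ X X "\<I> X"]) auto

lemma is_iso_cancel_left:
  assumes "is_iso C e" "f \<in> Ar C" "g \<in> Ar C" "e \<cdot> f = e \<cdot> g" "src C e = tgt C f" "tgt C f = tgt C g"
  shows "f = g"
proof -
  have [simp]: "e \<in> Ar C" using assms(1) by (simp add: is_iso_def)
  obtain d where d: "d \<in> Hom C (tgt C e) (src C e)" "d \<cdot> e = \<I> (src C e)"
    using assms(1) by (auto simp: is_iso_def)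
  have "d \<cdot> (e \<cdot> f) = f" "d \<cdot> (e \<cdot> g) = g"
    using d assms(2,3,5,6) by (simp_all add: comp_eq_assoc[OF d(2)])
  then show ?thesis using assms(4) by metis
qed

lemma is_iso_cancel_right:
  assumes "is_iso C e" "f \<in> Ar C" "g \<in> Ar C" "f \<cdot> e = g \<cdot> e" "tgt C e = src C f" "src C f = src C g"
  shows "f = g"
proof -
  have [simp]: "e \<in> Ar C" using assms(1) by (simp add: is_iso_def)
  obtain d where d: "d \<in> Hom C (tgt C e) (src C e)" "e \<cdot> d = \<I> (tgt C e)"
    using assms(1) by (auto simp: is_iso_def)
  have "(f \<cdot> e) \<cdot> d = f" "(g \<cdot> e) \<cdot> d = g"
    using d assms(2,3,5,6) by simp_all
  then show ?thesis using assms(4) by metis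
qed

text \<open>Naturality equates \<open>f\<close> and \<open>g\<close> up to a component of
  \<open>\<eta>\<close>, which is invertible and cancels. Both directions of \<open>\<eta>\<close>
  are treated because a unit starts at the identity functor and a counit ends there.\<close>

lemma natural_iso_id_faithful:
  assumes "natural_iso C id id Fo Fm \<eta> \<or> natural_iso C Fo Fm id id \<eta>"
    and "f \<in> Hom C X Y" "g \<in> Hom C X Y" "Fm f = Fm g"
  shows "f = g"
proof -
  have ob: "X \<in> Ob C" "Y \<in> Ob C" using assms(2) by auto
  from assms(1) show ?thesis
  proof
    assume n: "natural_iso C id id Fo Fm \<eta>"
    have "\<eta> Y \<cdot> f = \<eta> Y \<cdot> g" "is_iso C (\<eta> Y)" "\<eta> Y \<in> Hom C Y (Fo Y)"
      using n assms(2-) ob unfolding natural_iso_def by (metis id_apply)+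
    then show ?thesis using is_iso_cancel_left assms(2,3) by auto
  next
    assume n: "natural_iso C Fo Fm id id \<eta>"
    have "f \<cdot> \<eta> X = g \<cdot> \<eta> X" "is_iso C (\<eta> X)" "\<eta> X \<in> Hom C (Fo X) X"
      using n assms(2-) ob unfolding natural_iso_def by (metis id_apply)+
    then show ?thesis using is_iso_cancel_right assms(2,3) by auto
  qed
qed

lemma self_equivalence_faithful:
  assumes "self_equivalence C Fo Fm" "f \<in> Hom C X Y" "g \<in> Hom C X Y" "Fm f = Fm g"
  shows "f = g"
proof -
  obtain Go Gm \<eta> where "natural_iso C id id (Go \<circ> Fo) (Gm \<circ> Fm) \<eta>"
    using assms(1) unfolding self_equivalence_def by blast
  then show ?thesis using natural_iso_id_faithful assms(2-4) by (metis comp_apply)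
qed

text \<open>The preimage is \<open>Gm w\<close> conjugated by the unit. By naturality of the unit,
  \<open>Gm\<close> then takes the same value at \<open>Fm f\<close> and at \<open>w\<close>, and
  the counit makes \<open>Gm\<close> faithful.\<close>

lemma self_equivalence_full:
  assumes "self_equivalence C Fo Fm" "X \<in> Ob C" "Y \<in> Ob C" "w \<in> Hom C (Fo X) (Fo Y)"
  shows "\<exists>f \<in> Hom C X Y. Fm f = w"
proof -
  obtain Go Gm \<eta> \<epsilon> where F: "endofunctor C Fo Fm" and G: "endofunctor C Go Gm"
    and \<eta>: "natural_iso C id id (Go \<circ> Fo) (Gm \<circ> Fm) \<eta>"
    and \<epsilon>: "natural_iso C (Fo \<circ> Go) (Fm \<circ> Gm) id id \<epsilon>"
    using assms(1) unfolding self_equivalence_def by blast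
  have \<eta>X: "\<eta> X \<in> Hom C X (Go (Fo X))" "is_iso C (\<eta> X)"
    and \<eta>Y: "\<eta> Y \<in> Hom C Y (Go (Fo Y))" "is_iso C (\<eta> Y)"
    using \<eta> assms(2,3) unfolding natural_iso_def by auto
  obtain e where e: "e \<in> Hom C (Go (Fo Y)) Y" "\<eta> Y \<cdot> e = \<I> (Go (Fo Y))"
    using is_isoE[OF \<eta>Y(2,1)] by metis
  have Gw: "Gm w \<in> Hom C (Go (Fo X)) (Go (Fo Y))"
    using G assms(4) unfolding endofunctor_def by blast
  define f where "f = e \<cdot> (Gm w \<cdot> \<eta> X)"
  have f: "f \<in> Hom C X Y" using e \<eta>X Gw by (simp add: f_def)
  have Ff: "Fm f \<in> Hom C (Fo X) (Fo Y)"
    using F f unfolding endofunctor_def by blast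
  have GFf: "Gm (Fm f) \<in> Hom C (Go (Fo X)) (Go (Fo Y))"
    using G Ff unfolding endofunctor_def by blast
  have "Gm (Fm f) \<cdot> \<eta> X = \<eta> Y \<cdot> f"
    using \<eta> f unfolding natural_iso_def by (metis id_apply comp_apply)
  also have "\<dots> = Gm w \<cdot> \<eta> X"
    using e \<eta>X \<eta>Y Gw by (simp add: f_def comp_eq_assoc[OF e(2)])
  finally have "Gm (Fm f) = Gm w"
    using is_iso_cancel_right[OF \<eta>X(2)] GFf Gw \<eta>X by auto
  then have "Fm f = w"
    using natural_iso_id_faithful[OF disjI2[OF \<epsilon>] Ff assms(4)] by simp
  then show ?thesis using f by blast
qed

end

section \<open>Arithmetic of morphisms in an additive category\<close>

context additive_category begin

lemma Hom_group_simps [simp]: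
  "carrier (Hom_group C X Y) = Hom C X Y" "mult (Hom_group C X Y) = plus_mor C"
  "one (Hom_group C X Y) = \<O> X Y"
  by (simp_all add: Hom_group_def)

lemma plus_simps [simp]:
  assumes "f \<in> Ar C" "g \<in> Ar C" "src C f = src C g" "tgt C f = tgt C g"
  shows "f \<oplus> g \<in> Ar C" "src C (f \<oplus> g) = src C g" "tgt C (f \<oplus> g) = tgt C g"
proof -
  interpret G: comm_group "Hom_group C (src C g) (tgt C g)" using assms Hom_comm_group by simp
  show "f \<oplus> g \<in> Ar C" "src C (f \<oplus> g) = src C g" "tgt C (f \<oplus> g) = tgt C g"
    using G.m_closed[of f g] assms by auto
qed

lemma zero_simps [simp]:
  assumes "X \<in> Ob C" "Y \<in> Ob C"
  shows "\<O> X Y \<in> Ar C" "src C (\<O> X Y) = X" "tgt C (\<O> X Y) = Y"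
proof -
  interpret G: comm_group "Hom_group C X Y" using assms Hom_comm_group by simp
  show "\<O> X Y \<in> Ar C" "src C (\<O> X Y) = X" "tgt C (\<O> X Y) = Y"
    using G.one_closed by auto
qed

lemma neg_simps [simp]:
  assumes "f \<in> Ar C"
  shows "\<ominus> f \<in> Ar C" "src C (\<ominus> f) = src C f" "tgt C (\<ominus> f) = tgt C f"
proof -
  interpret G: comm_group "Hom_group C (src C f) (tgt C f)" using assms Hom_comm_group by simp
  show "\<ominus> f \<in> Ar C" "src C (\<ominus> f) = src C f" "tgt C (\<ominus> f) = tgt C f"
    using G.inv_closed[of f] assms by (auto simp: neg_mor_def)
qed

lemma plus_assoc [simp]:
  assumes "f \<in> Ar C" "g \<in> Ar C" "k \<in> Ar C" "src C f = src C g" "tgt C f = tgt C g"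
    "src C g = src C k" "tgt C g = tgt C k"
  shows "(f \<oplus> g) \<oplus> k = f \<oplus> (g \<oplus> k)"
proof -
  interpret G: comm_group "Hom_group C (src C k) (tgt C k)" using assms Hom_comm_group by simp
  show ?thesis using G.m_assoc[of f g k] assms by auto
qed

lemma plus_comm:
  assumes "f \<in> Ar C" "g \<in> Ar C" "src C f = src C g" "tgt C f = tgt C g"
  shows "f \<oplus> g = g \<oplus> f"
proof -
  interpret G: comm_group "Hom_group C (src C g) (tgt C g)" using assms Hom_comm_group by simp
  show ?thesis using G.m_comm[of f g] assms by auto
qed

lemma plus_left_comm:
  assumes "f \<in> Ar C" "g \<in> Ar C" "k \<in> Ar C" "src C f = src C g" "tgt C f = tgt C g"
    "src C g = src C k" "tgt C g = tgt C k"
  shows "f \<oplus> (g \<oplus> k) = g \<oplus> (f \<oplus> k)"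
proof -
  have "f \<oplus> (g \<oplus> k) = (f \<oplus> g) \<oplus> k" using assms by simp
  also have "f \<oplus> g = g \<oplus> f" using assms by (intro plus_comm) simp_all
  also have "(g \<oplus> f) \<oplus> k = g \<oplus> (f \<oplus> k)" using assms by simp
  finally show ?thesis .
qed

lemma plus_zero [simp]:
  assumes "f \<in> Ar C" "src C f = X" "tgt C f = Y"
  shows "\<O> X Y \<oplus> f = f" "f \<oplus> \<O> X Y = f"
proof -
  have ob: "X \<in> Ob C" "Y \<in> Ob C" using assms by auto
  interpret G: comm_group "Hom_group C X Y" using ob Hom_comm_group by simp
  show "\<O> X Y \<oplus> f = f" using G.l_one[of f] assms by auto
  show "f \<oplus> \<O> X Y = f" using G.r_one[of f] assms by auto
qed

lemma plus_neg [simp]: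
  assumes "f \<in> Ar C"
  shows "f \<oplus> \<ominus> f = \<O> (src C f) (tgt C f)" "\<ominus> f \<oplus> f = \<O> (src C f) (tgt C f)"
proof -
  interpret G: comm_group "Hom_group C (src C f) (tgt C f)" using assms Hom_comm_group by simp
  show "f \<oplus> \<ominus> f = \<O> (src C f) (tgt C f)" "\<ominus> f \<oplus> f = \<O> (src C f) (tgt C f)"
    using G.r_inv[of f] G.l_inv[of f] assms by (auto simp: neg_mor_def)
qed

lemma plus_neg_cancel [simp]:
  assumes "f \<in> Ar C" "k \<in> Ar C" "src C f = src C k" "tgt C f = tgt C k"
  shows "f \<oplus> (\<ominus> f \<oplus> k) = k" "\<ominus> f \<oplus> (f \<oplus> k) = k"
proof -
  have "f \<oplus> (\<ominus> f \<oplus> k) = (f \<oplus> \<ominus> f) \<oplus> k" "\<ominus> f \<oplus> (f \<oplus> k) = (\<ominus> f \<oplus> f) \<oplus> k"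
    using assms by (simp_all del: plus_neg)
  then show "f \<oplus> (\<ominus> f \<oplus> k) = k" "\<ominus> f \<oplus> (f \<oplus> k) = k"
    using assms by (simp_all del: plus_assoc)
qed

lemma neg_unique:
  assumes "f \<in> Ar C" "g \<in> Ar C" "src C f = src C g" "tgt C f = tgt C g"
    and "f \<oplus> g = \<O> (src C f) (tgt C f)"
  shows "g = \<ominus> f"
proof -
  have "g = \<ominus> f \<oplus> (f \<oplus> g)" using assms(1-4) by simp
  also have "\<dots> = \<ominus> f" using assms(1-4) by (simp add: assms(5) del: plus_neg_cancel)
  finally show ?thesis .
qed

lemma neg_neg [simp]: "f \<in> Ar C \<Longrightarrow> \<ominus> (\<ominus> f) = f"
  by (rule neg_unique[symmetric]) auto

lemma neg_eq_imp_eq: "\<ominus> f = \<ominus> g \<Longrightarrow> f \<in> Ar C \<Longrightarrow> g \<in> Ar C \<Longrightarrow> f = g"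
  using neg_neg by metis

lemma neg_zero [simp]: "X \<in> Ob C \<Longrightarrow> Y \<in> Ob C \<Longrightarrow> \<ominus> (\<O> X Y) = \<O> X Y"
  by (rule neg_unique[symmetric]) auto

lemma neg_plus [simp]:
  assumes "f \<in> Ar C" "g \<in> Ar C" "src C f = src C g" "tgt C f = tgt C g"
  shows "\<ominus> (f \<oplus> g) = \<ominus> f \<oplus> \<ominus> g"
proof (rule neg_unique[symmetric])
  have "g \<oplus> (\<ominus> f \<oplus> \<ominus> g) = \<ominus> f \<oplus> (g \<oplus> \<ominus> g)"
    using assms by (intro plus_left_comm) simp_all
  then show "(f \<oplus> g) \<oplus> (\<ominus> f \<oplus> \<ominus> g) = \<O> (src C (f \<oplus> g)) (tgt C (f \<oplus> g))"
    using assms by simp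
qed (use assms in simp_all)

lemma comp_plus [simp]:
  assumes "f \<in> Ar C" "g \<in> Ar C" "src C f = src C g" "tgt C f = tgt C g" "k \<in> Ar C"
  shows "src C k = tgt C f \<Longrightarrow> k \<cdot> (f \<oplus> g) = (k \<cdot> f) \<oplus> (k \<cdot> g)"
    "tgt C k = src C f \<Longrightarrow> (f \<oplus> g) \<cdot> k = (f \<cdot> k) \<oplus> (g \<cdot> k)"
  using assms compose_plus_left compose_plus_right by auto

lemma plus_idem_zero:
  assumes "f \<in> Ar C" "f \<oplus> f = f"
  shows "f = \<O> (src C f) (tgt C f)"
proof -
  have "f = \<ominus> f \<oplus> (f \<oplus> f)" using assms(1) by simp
  also have "\<dots> = \<O> (src C f) (tgt C f)" unfolding assms(2) using assms(1) by simp
  finally show ?thesis .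
qed

text \<open>The composite inherits \<open>0 + 0 = 0\<close> by additivity, and zero is the only
  morphism that equals its own double.\<close>

lemma comp_zero_right [simp]:
  assumes "f \<in> Ar C" "X \<in> Ob C" "src C f = Y"
  shows "f \<cdot> \<O> X Y = \<O> X (tgt C f)"
proof -
  have Y: "Y \<in> Ob C" using assms by auto
  have "f \<cdot> \<O> X Y \<oplus> f \<cdot> \<O> X Y = f \<cdot> (\<O> X Y \<oplus> \<O> X Y)"
    using assms Y by (simp del: plus_zero)
  also have "\<dots> = f \<cdot> \<O> X Y" using assms Y by simp
  finally show ?thesis using plus_idem_zero[of "f \<cdot> \<O> X Y"] assms Y by simp
qed

lemma comp_zero_left [simp]:
  assumes "f \<in> Ar C" "Z \<in> Ob C" "tgt C f = Y"
  shows "\<O> Y Z \<cdot> f = \<O> (src C f) Z"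
proof -
  have Y: "Y \<in> Ob C" using assms by auto
  have "\<O> Y Z \<cdot> f \<oplus> \<O> Y Z \<cdot> f = (\<O> Y Z \<oplus> \<O> Y Z) \<cdot> f"
    using assms Y by (simp del: plus_zero)
  also have "\<dots> = \<O> Y Z \<cdot> f" using assms Y by simp
  finally show ?thesis using plus_idem_zero[of "\<O> Y Z \<cdot> f"] assms Y by simp
qed

lemma comp_neg [simp]:
  assumes "f \<in> Ar C" "g \<in> Ar C" "src C g = tgt C f"
  shows "\<ominus> g \<cdot> f = \<ominus> (g \<cdot> f)" "g \<cdot> \<ominus> f = \<ominus> (g \<cdot> f)"
proof -
  have "g \<cdot> f \<oplus> \<ominus> g \<cdot> f = (g \<oplus> \<ominus> g) \<cdot> f" using assms by (simp del: plus_neg)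
  then show "\<ominus> g \<cdot> f = \<ominus> (g \<cdot> f)" using assms by (intro neg_unique) auto
  have "g \<cdot> f \<oplus> g \<cdot> \<ominus> f = g \<cdot> (f \<oplus> \<ominus> f)" using assms by (simp del: plus_neg)
  then show "g \<cdot> \<ominus> f = \<ominus> (g \<cdot> f)" using assms by (intro neg_unique) auto
qed

section \<open>Zero objects and split epimorphisms\<close>

lemma zero_object_eq:
  assumes "zero_object C N" "X \<in> Ob C"
  shows "f \<in> Hom C X N \<Longrightarrow> f = \<O> X N" "f \<in> Hom C N X \<Longrightarrow> f = \<O> N X"
proof -
  have N: "N \<in> Ob C" using assms(1) by (simp add: zero_object_def)
  have "\<O> X N \<in> Hom C X N" "\<O> N X \<in> Hom C N X" using N assms(2) by auto
  then show "f \<in> Hom C X N \<Longrightarrow> f = \<O> X N" "f \<in> Hom C N X \<Longrightarrow> f = \<O> N X"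
    using assms unfolding zero_object_def by metis+
qed

text \<open>Every map into or out of \<open>N\<close> factors through \<open>\<I> N\<close> and is
  therefore zero.\<close>

lemma zero_objectI:
  assumes N: "N \<in> Ob C" and id: "\<I> N = \<O> N N"
  shows "zero_object C N"
proof -
  have "f = \<O> X N" if "f \<in> Hom C X N" for f X
  proof -
    have "f = \<I> N \<cdot> f" using that by simp
    then show ?thesis unfolding id using that N by simp
  qed
  moreover have "f = \<O> N X" if "f \<in> Hom C N X" for f X
  proof -
    have "f = f \<cdot> \<I> N" using that by simp
    then show ?thesis unfolding id using that N by simp
  qed
  moreover have "\<O> X N \<in> Hom C X N" "\<O> N X \<in> Hom C N X" if "X \<in> Ob C" for X
    using N that by simp_all
  ultimately show ?thesis unfolding zero_object_def using N by metis
qed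

lemma plus_neg_eq_zero_imp_eq:
  assumes "f \<in> Hom C X Y" "g \<in> Hom C X Y" "f \<oplus> \<ominus> g = \<O> X Y"
  shows "f = g"
proof -
  have "\<ominus> g = \<ominus> f" using assms by (intro neg_unique) simp_all
  from neg_eq_imp_eq[OF this] show ?thesis using assms(1,2) by auto
qed

text \<open>The endomorphism \<open>g f - 1\<close> of \<open>X\<close> is killed by
  \<open>f\<close>, because \<open>f g f = f\<close>; so cancellation on endomorphisms suffices.
  Comparison maps between cones are shown to be invertible in this way.\<close>

lemma split_epi_mono_is_iso:
  assumes f: "f \<in> Hom C X Y" and g: "g \<in> Hom C Y X" and fg: "f \<cdot> g = \<I> Y"
    and mono: "\<And>x. x \<in> Hom C X X \<Longrightarrow> f \<cdot> x = \<O> X Y \<Longrightarrow> x = \<O> X X"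
  shows "is_iso C f"
proof (rule is_isoI[OF f g _ fg])
  have ob: "X \<in> Ob C" using f by auto
  have "(g \<cdot> f) \<oplus> \<ominus> \<I> X = \<O> X X"
    using f g ob by (intro mono) (auto simp: comp_eq_assoc[OF fg])
  then show "g \<cdot> f = \<I> X"
    by (rule plus_neg_eq_zero_imp_eq[rotated 2]) (use f g ob in auto)
qed

section \<open>Biproducts\<close>

lemma biproduct_commute:
  assumes "biproduct C X Y B i j p q"
  shows "biproduct C Y X B j i q p"
proof -
  have "j \<cdot> q \<oplus> i \<cdot> p = i \<cdot> p \<oplus> j \<cdot> q"
    using assms by (intro plus_comm) (simp_all add: biproduct_def)
  then show ?thesis using assms unfolding biproduct_def by metis
qed

lemma biproduct_simps:
  assumes "biproduct C X Y B i j p q"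
  shows "X \<in> Ob C" "Y \<in> Ob C" "B \<in> Ob C"
    "i \<in> Ar C" "src C i = X" "tgt C i = B" "j \<in> Ar C" "src C j = Y" "tgt C j = B"
    "p \<in> Ar C" "src C p = B" "tgt C p = X" "q \<in> Ar C" "src C q = B" "tgt C q = Y"
    "p \<cdot> i = \<I> X" "q \<cdot> j = \<I> Y" "p \<cdot> j = \<O> Y X" "q \<cdot> i = \<O> X Y"
    "x \<in> Ar C \<Longrightarrow> tgt C x = X \<Longrightarrow> p \<cdot> (i \<cdot> x) = x"
    "x \<in> Ar C \<Longrightarrow> tgt C x = X \<Longrightarrow> q \<cdot> (i \<cdot> x) = \<O> (src C x) Y"
    "x \<in> Ar C \<Longrightarrow> tgt C x = Y \<Longrightarrow> q \<cdot> (j \<cdot> x) = x"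
    "x \<in> Ar C \<Longrightarrow> tgt C x = Y \<Longrightarrow> p \<cdot> (j \<cdot> x) = \<O> (src C x) X"
proof -
  have eq: "p \<cdot> i = \<I> X" "q \<cdot> j = \<I> Y" "p \<cdot> j = \<O> Y X" "q \<cdot> i = \<O> X Y"
    and hom [simp]: "i \<in> Ar C" "src C i = X" "tgt C i = B" "j \<in> Ar C" "src C j = Y" "tgt C j = B"
    "p \<in> Ar C" "src C p = B" "tgt C p = X" "q \<in> Ar C" "src C q = B" "tgt C q = Y"
    using assms by (auto simp: biproduct_def)
  show ob: "X \<in> Ob C" "Y \<in> Ob C" "B \<in> Ob C"
    using src_closed[of i] src_closed[of j] src_closed[of p] by simp_all
  show "p \<cdot> i = \<I> X" "q \<cdot> j = \<I> Y" "p \<cdot> j = \<O> Y X" "q \<cdot> i = \<O> X Y"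
    by (fact eq)+
  show "x \<in> Ar C \<Longrightarrow> tgt C x = X \<Longrightarrow> p \<cdot> (i \<cdot> x) = x"
    "x \<in> Ar C \<Longrightarrow> tgt C x = X \<Longrightarrow> q \<cdot> (i \<cdot> x) = \<O> (src C x) Y"
    "x \<in> Ar C \<Longrightarrow> tgt C x = Y \<Longrightarrow> q \<cdot> (j \<cdot> x) = x"
    "x \<in> Ar C \<Longrightarrow> tgt C x = Y \<Longrightarrow> p \<cdot> (j \<cdot> x) = \<O> (src C x) X"
    using ob by (simp_all add: eq[THEN comp_eq_assoc])
qed (use assms in \<open>auto simp: biproduct_def\<close>)

lemma biproduct_decomp_target:
  assumes "biproduct C X Y B i j p q" "x \<in> Ar C" "tgt C x = B"
  shows "(i \<cdot> (p \<cdot> x)) \<oplus> (j \<cdot> (q \<cdot> x)) = x"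
proof -
  note [simp] = biproduct_simps[OF assms(1)]
  have "((i \<cdot> p) \<oplus> (j \<cdot> q)) \<cdot> x = \<I> B \<cdot> x"
    using assms(1) by (simp only: biproduct_def)
  then show ?thesis using assms(2,3) by simp
qed

lemma biproduct_decomp_source:
  assumes "biproduct C X Y B i j p q" "x \<in> Ar C" "src C x = B"
  shows "(x \<cdot> (i \<cdot> p)) \<oplus> (x \<cdot> (j \<cdot> q)) = x"
proof -
  note [simp] = biproduct_simps[OF assms(1)]
  have "x \<cdot> ((i \<cdot> p) \<oplus> (j \<cdot> q)) = x \<cdot> \<I> B"
    using assms(1) by (simp only: biproduct_def)
  then show ?thesis using assms(2,3) by simp
qed

lemma biproduct_ext_source:
  assumes B: "biproduct C X Y B i j p q" and x: "x \<in> Hom C B M" and y: "y \<in> Hom C B M"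
    and "x \<cdot> i = y \<cdot> i" "x \<cdot> j = y \<cdot> j"
  shows "x = y"
proof -
  note [simp] = biproduct_simps[OF B]
  have *: "z = ((z \<cdot> i) \<cdot> p) \<oplus> ((z \<cdot> j) \<cdot> q)" if "z \<in> Hom C B M" for z
    using biproduct_decomp_source[OF B] that by simp
  show ?thesis using *[OF x] *[OF y] assms(4,5) by metis
qed

end

section \<open>Suspension and exact triangles\<close>

context triangulated_category begin

lemma susp_endofunctor: "endofunctor T (susp_ob T) (susp T)"
  using susp_self_equivalence by (simp add: self_equivalence_def)

lemma susp_simps [simp]:
  shows "X \<in> Ob T \<Longrightarrow> susp_ob T X \<in> Ob T"
    "f \<in> Ar T \<Longrightarrow> susp T f \<in> Ar T"
    "f \<in> Ar T \<Longrightarrow> src T (susp T f) = susp_ob T (src T f)"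
    "f \<in> Ar T \<Longrightarrow> tgt T (susp T f) = susp_ob T (tgt T f)"
    "X \<in> Ob T \<Longrightarrow> susp T (\<I> X) = \<I> (susp_ob T X)"
    "f \<in> Ar T \<Longrightarrow> g \<in> Ar T \<Longrightarrow> src T g = tgt T f \<Longrightarrow> susp T (g \<cdot> f) = susp T g \<cdot> susp T f"
    "f \<in> Ar T \<Longrightarrow> g \<in> Ar T \<Longrightarrow> src T f = src T g \<Longrightarrow> tgt T f = tgt T g \<Longrightarrow>
      susp T (f \<oplus> g) = susp T f \<oplus> susp T g"
  using susp_endofunctor susp_plus unfolding endofunctor_def by auto

lemma susp_zero [simp]:
  assumes "X \<in> Ob T" "Y \<in> Ob T"
  shows "susp T (\<O> X Y) = \<O> (susp_ob T X) (susp_ob T Y)"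
proof -
  have "susp T (\<O> X Y) \<oplus> susp T (\<O> X Y) = susp T (\<O> X Y \<oplus> \<O> X Y)"
    using assms by (simp del: plus_zero)
  also have "\<dots> = susp T (\<O> X Y)" using assms by simp
  finally show ?thesis using assms plus_idem_zero[of "susp T (\<O> X Y)"] by simp
qed

lemma susp_neg [simp]:
  assumes "f \<in> Ar T"
  shows "susp T (\<ominus> f) = \<ominus> susp T f"
proof (rule neg_unique)
  have "susp T f \<oplus> susp T (\<ominus> f) = susp T (f \<oplus> \<ominus> f)"
    using assms by (simp del: plus_neg)
  then show "susp T f \<oplus> susp T (\<ominus> f) = \<O> (src T (susp T f)) (tgt T (susp T f))"
    using assms by simp
qed (use assms in simp_all)

lemma exact_simps:
  assumes "exact T f g h"
  shows "f \<in> Ar T" "g \<in> Ar T" "h \<in> Ar T" "src T g = tgt T f" "src T h = tgt T g"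
    "tgt T h = susp_ob T (src T f)"
  using exact_candidate[OF assms] by (auto simp: candidate_triangle_def)

lemma candidate_triangleI:
  "f \<in> Hom T X Y \<Longrightarrow> g \<in> Hom T Y Z \<Longrightarrow> h \<in> Hom T Z (susp_ob T X) \<Longrightarrow> candidate_triangle T f g h"
  unfolding candidate_triangle_def by blast

lemma exact_rotate: "exact T f g h \<Longrightarrow> exact T g h (\<ominus> susp T f)"
  using TR2_rotate exact_candidate by blast

lemma exact_fill:
  assumes "exact T f g h" "exact T f' g' h'"
    and "u \<in> Hom T (src T f) (src T f')" "v \<in> Hom T (tgt T f) (tgt T f')" "v \<cdot> f = f' \<cdot> u"
  obtains w where "w \<in> Hom T (tgt T g) (tgt T g')" "w \<cdot> g = g' \<cdot> v" "susp T u \<cdot> h = h' \<cdot> w"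
  using TR3_fill[OF assms] exact_simps[OF assms(1)] exact_simps[OF assms(2)]
  unfolding triangle_morphism_def by metis

text \<open>The identity triangle on the source of \<open>f\<close> maps to the given triangle with
  first components \<open>1\<close> and \<open>f\<close>; its third component factors
  \<open>g f\<close> through a zero object. Rotation gives the other two composites.\<close>

lemma exact_comp_zero:
  assumes "exact T f g h"
  shows "g \<cdot> f = \<O> (src T f) (tgt T g)" "h \<cdot> g = \<O> (src T g) (tgt T h)"
    "susp T f \<cdot> h = \<O> (src T h) (susp_ob T (tgt T f))"
proof -
  have base: "g \<cdot> f = \<O> (src T f) (tgt T g)" if ex: "exact T f g h" for f g h
  proof -
    note [simp] = exact_simps[OF ex]
    obtain N where N: "zero_object T N" using zero_object_exists by blast
    then have [simp]: "N \<in> Ob T" by (simp add: zero_object_def)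
    have "exact T (\<I> (src T f)) (\<O> (src T f) N) (\<O> N (susp_ob T (src T f)))"
      using TR1_ident N by simp
    from exact_fill[OF this ex, of "\<I> (src T f)" f]
    obtain w where "w \<in> Hom T N (tgt T g)" "w \<cdot> \<O> (src T f) N = g \<cdot> f" by auto
    then show ?thesis by auto
  qed
  show "g \<cdot> f = \<O> (src T f) (tgt T g)" using base assms .
  show "h \<cdot> g = \<O> (src T g) (tgt T h)" using base exact_rotate[OF assms] by blast
  note [simp] = exact_simps[OF assms]
  have "\<ominus> susp T f \<cdot> h = \<O> (src T h) (susp_ob T (tgt T f))"
    using base[OF exact_rotate[OF exact_rotate[OF assms]]] by simp
  then have "\<ominus> (susp T f \<cdot> h) = \<ominus> \<O> (src T h) (susp_ob T (tgt T f))" by simp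
  then show "susp T f \<cdot> h = \<O> (src T h) (susp_ob T (tgt T f))"
    by (rule neg_eq_imp_eq) simp_all
qed

lemma zero_object_susp: "zero_object T N \<Longrightarrow> zero_object T (susp_ob T N)"
proof (rule zero_objectI)
  assume N: "zero_object T N"
  then show "susp_ob T N \<in> Ob T" by (simp add: zero_object_def)
  have NO: "N \<in> Ob T" using N by (simp add: zero_object_def)
  have "\<I> N = \<O> N N" using zero_object_eq(1)[OF N NO, of "\<I> N"] NO by simp
  then have "susp T (\<I> N) = susp T (\<O> N N)" by simp
  then show "\<I> (susp_ob T N) = \<O> (susp_ob T N) (susp_ob T N)" using NO by simp
qed

text \<open>The equation \<open>x f = 0\<close> is the first commuting square of a morphism to the
  triangle \<open>N \<rightarrow> M = M \<rightarrow> \<Sigma> N\<close> with \<open>N\<close> zero.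
  The third component of that morphism is \<open>k\<close>.\<close>

lemma exact_weak_cokernel:
  assumes ex: "exact T f g h" and x: "x \<in> Hom T (tgt T f) M" and 0: "x \<cdot> f = \<O> (src T f) M"
  obtains k where "k \<in> Hom T (tgt T g) M" "x = k \<cdot> g"
proof -
  note [simp] = exact_simps[OF ex]
  have [simp]: "M \<in> Ob T" using x by auto
  obtain N where N: "zero_object T N" using zero_object_exists by blast
  then have [simp]: "N \<in> Ob T" by (simp add: zero_object_def)
  \<comment> \<open>The suspended zero object gives this identity triangle the shape of a rotated
    triangle, so that the rotation can be undone.\<close>
  have "exact T (\<I> M) (\<O> M (susp_ob T N)) (\<ominus> susp T (\<O> N M))"
    using TR1_ident[of M "susp_ob T N"] zero_object_susp[OF N] by simp
  then have "exact T (\<O> N M) (\<I> M) (\<O> M (susp_ob T N))"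
    by (subst TR2_rotate) (auto intro!: candidate_triangleI[of _ N M _ M])
  from exact_fill[OF ex this, of "\<O> (src T f) N" x] x 0
  obtain w where "w \<in> Hom T (tgt T g) M" "w \<cdot> g = \<I> M \<cdot> x" by auto
  then show ?thesis using x that[of w] by simp
qed

text \<open>The triangle starting with \<open>M \<rightarrow> 0\<close> maps to the rotated triangle
  by \<open>y\<close> and zero. The third component runs between suspensions: fullness of \<Sigma>
  produces \<open>x\<close> from it, and faithfulness removes \<Sigma> from the resulting
  equation.\<close>

lemma exact_weak_kernel:
  assumes ex: "exact T f g h" and y: "y \<in> Hom T M (src T g)" and 0: "g \<cdot> y = \<O> M (tgt T g)"
  obtains x where "x \<in> Hom T M (src T f)" "y = f \<cdot> x"
proof -
  note [simp] = exact_simps[OF ex]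
  have [simp]: "M \<in> Ob T" using y by auto
  obtain N where N: "zero_object T N" using zero_object_exists by blast
  then have [simp]: "N \<in> Ob T" by (simp add: zero_object_def)
  have "exact T (\<O> M N) (\<O> N (susp_ob T M)) (\<ominus> susp T (\<I> M))"
    by (rule exact_rotate[OF TR1_ident[OF _ N]]) simp
  from exact_fill[OF this exact_rotate[OF ex], of y "\<O> N (tgt T g)"] y 0
  obtain w where w: "w \<in> Hom T (susp_ob T M) (susp_ob T (src T f))"
    "susp T y \<cdot> (\<ominus> \<I> (susp_ob T M)) = \<ominus> susp T f \<cdot> w" by auto
  obtain x where x: "x \<in> Hom T M (src T f)" "susp T x = w"
    using self_equivalence_full[OF susp_self_equivalence _ _ w(1)] by auto
  have "\<ominus> susp T y = \<ominus> susp T (f \<cdot> x)" using w x y by auto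
  then have "susp T y = susp T (f \<cdot> x)"
    by (rule neg_eq_imp_eq) (use x(1) y in auto)
  then have "y = f \<cdot> x"
    using self_equivalence_faithful[OF susp_self_equivalence, of y M "src T g" "f \<cdot> x"] x(1) y
    by auto
  then show ?thesis using that x by blast
qed

text \<open>This is the weak kernel property of the triangle rotated twice, whose first two maps are
  \<open>h\<close> and \<open>- \<Sigma> f\<close>.\<close>

lemma exact_weak_kernel_connecting:
  assumes ex: "exact T f g h" and y: "y \<in> Hom T M (susp_ob T (src T f))"
    and 0: "susp T f \<cdot> y = \<O> M (susp_ob T (tgt T f))"
  obtains x where "x \<in> Hom T M (tgt T g)" "y = h \<cdot> x"
proof -
  note [simp] = exact_simps[OF ex]
  have [simp]: "M \<in> Ob T" using y by auto
  have "\<ominus> susp T f \<cdot> y = \<O> M (susp_ob T (tgt T f))" using y 0 by auto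
  then show ?thesis
    using exact_weak_kernel[OF exact_rotate[OF exact_rotate[OF ex]], of y M] y that by auto
qed

lemma exact_iso:
  assumes ex: "exact T f g h" and w: "w \<in> Hom T (tgt T g) Z" "is_iso T w"
    and h': "h' \<in> Hom T Z (susp_ob T (src T f))" "h' \<cdot> w = h"
  shows "exact T f (w \<cdot> g) h'"
proof (rule TR1_iso[OF ex, of _ _ _ "\<I> (src T f)" "\<I> (tgt T f)" w])
  note [simp] = exact_simps[OF ex]
  show "triangle_morphism T f g h f (w \<cdot> g) h' (\<I> (src T f)) (\<I> (tgt T f)) w"
    using w h' exact_candidate[OF ex] unfolding triangle_morphism_def
    by (auto intro!: candidate_triangleI[of _ "src T f" "tgt T f" _ Z])
qed (use w exact_simps[OF ex] in \<open>auto intro: is_iso_ident\<close>)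

section \<open>Adding a trivial triangle to an exact triangle\<close>

lemma biproduct_susp:
  assumes "biproduct T X Y B i j p q"
  shows "biproduct T (susp_ob T X) (susp_ob T Y) (susp_ob T B) (susp T i) (susp T j)
    (susp T p) (susp T q)"
proof -
  note [simp] = biproduct_simps[OF assms]
  have "susp T ((i \<cdot> p) \<oplus> (j \<cdot> q)) = susp T (\<I> B)"
    using assms by (simp only: biproduct_def)
  then show ?thesis unfolding biproduct_def by (simp flip: susp_simps(6))
qed

text \<open>This adds the triangle \<open>N = N \<rightarrow> 0\<close>. Exactness of a sum is not
  an axiom, so an exact triangle \<open>F\<close>, \<open>c\<close>, \<open>d\<close> is chosen and
  a fill-in \<open>w\<close> from the cone of \<open>f\<close> to that of \<open>F\<close> is shown
  to be invertible. Transport along its inverse gives the claim.\<close>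

lemma exact_sum_identity:
  assumes ex: "exact T f g h"
    and A: "biproduct T (src T f) N A i1 i2 p1 p2"
    and B: "biproduct T (tgt T f) N B j1 j2 q1 q2"
  shows "exact T ((j1 \<cdot> (f \<cdot> p1)) \<oplus> (j2 \<cdot> p2)) (g \<cdot> q1) (susp T i1 \<cdot> h)"
proof -
  define X Y Z where "X = src T f" and "Y = tgt T f" and "Z = tgt T g"
  have [simp]: "f \<in> Ar T" "g \<in> Ar T" "h \<in> Ar T" "src T f = X" "tgt T f = Y"
    "src T g = Y" "tgt T g = Z" "src T h = Z" "tgt T h = susp_ob T X"
    using exact_simps[OF ex] by (simp_all add: X_def Y_def Z_def)
  have [simp]: "X \<in> Ob T" "Y \<in> Ob T" "Z \<in> Ob T"
    using src_closed[of f] tgt_closed[of f] tgt_closed[of g] by simp_all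
  note A = A[simplified] and B = B[simplified]
  note [simp] = biproduct_simps[OF A] biproduct_simps[OF B]
  note susp_A = biproduct_simps(16-)[OF biproduct_susp[OF A]]
    and susp_B = biproduct_simps(16-)[OF biproduct_susp[OF B]]
  define F where "F = (j1 \<cdot> (f \<cdot> p1)) \<oplus> (j2 \<cdot> p2)"
  have F [simp]: "F \<in> Ar T" "src T F = A" "tgt T F = B"
    by (simp_all add: F_def)
  obtain c d where ex': "exact T F c d" using TR1_complete[OF F(1)] by blast
  define D where "D = tgt T c"
  have [simp]: "c \<in> Ar T" "src T c = B" "tgt T c = D" "d \<in> Ar T" "src T d = D"
    "tgt T d = susp_ob T A"
    using exact_simps[OF ex'] by (simp_all add: D_def)
  have [simp]: "D \<in> Ob T" using src_closed[of d] by simp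
  obtain w where w: "w \<in> Hom T Z D" "w \<cdot> g = c \<cdot> j1" "susp T i1 \<cdot> h = d \<cdot> w"
    by (rule exact_fill[OF ex ex', of i1 j1]) (auto simp: F_def)
  note [simp] = w(1)[unfolded mem_Hom]
  have "(c \<cdot> F) \<cdot> i2 = \<O> A D \<cdot> i2" using exact_comp_zero(1)[OF ex'] by simp
  then have cj2: "c \<cdot> j2 = \<O> N D" by (simp add: F_def)
  have Fd: "susp T F \<cdot> d = \<O> D (susp_ob T B)" using exact_comp_zero(3)[OF ex'] by simp
  \<comment> \<open>If \<open>w x = 0\<close>, then \<open>h x = 0\<close>, so
    \<open>x = g y\<close>. Now \<open>c\<close> kills \<open>j1 y\<close>, which therefore factors
    through \<open>F\<close>; this makes \<open>y\<close> factor through \<open>f\<close>, and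
    \<open>g f = 0\<close>.\<close>
  have mono: "x = \<O> Z Z" if x: "x \<in> Hom T Z Z" and wx: "w \<cdot> x = \<O> Z D" for x
  proof -
    note [simp] = x[unfolded mem_Hom]
    have "susp T i1 \<cdot> (h \<cdot> x) = (d \<cdot> w) \<cdot> x" unfolding w(3)[symmetric] by simp
    also have "\<dots> = \<O> Z (susp_ob T A)" using wx by simp
    finally have "susp T p1 \<cdot> (susp T i1 \<cdot> (h \<cdot> x)) = susp T p1 \<cdot> \<O> Z (susp_ob T A)" by simp
    then have "h \<cdot> x = \<O> Z (susp_ob T X)" by (simp add: susp_A)
    then obtain y where y: "y \<in> Hom T Z Y" "x = g \<cdot> y"
      using exact_weak_kernel[OF exact_rotate[OF ex], of x Z] by auto
    note [simp] = y(1)[unfolded mem_Hom]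
    have "c \<cdot> (j1 \<cdot> y) = \<O> Z D"
      using wx unfolding y(2) by (simp add: comp_eq_assoc[OF w(2)])
    then obtain z where z: "z \<in> Hom T Z A" "j1 \<cdot> y = F \<cdot> z"
      using exact_weak_kernel[OF ex', of "j1 \<cdot> y" Z] by auto
    note [simp] = z(1)[unfolded mem_Hom]
    have "q1 \<cdot> (j1 \<cdot> y) = q1 \<cdot> (F \<cdot> z)" using z by simp
    then have "y = f \<cdot> (p1 \<cdot> z)" by (simp add: F_def)
    then show ?thesis unfolding y(2)
      by (simp add: comp_eq_assoc[OF exact_comp_zero(1)[OF ex]])
  qed
  \<comment> \<open>A section of \<open>w\<close> is built next. The components of
    \<open>\<Sigma> F d = 0\<close> show that \<open>d\<close> has no part along \<open>N\<close>
    and that its part along \<open>X\<close> factors through \<open>h\<close>. Hence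
    \<open>d = d w k\<close>, and \<open>1 - w k\<close> factors through \<open>c\<close>.\<close>
  have "susp T q1 \<cdot> (susp T F \<cdot> d) = \<O> D (susp_ob T Y)" unfolding Fd by simp
  then have "susp T f \<cdot> (susp T p1 \<cdot> d) = \<O> D (susp_ob T Y)" by (simp add: F_def susp_B)
  then obtain k where k: "k \<in> Hom T D Z" "susp T p1 \<cdot> d = h \<cdot> k"
    using exact_weak_kernel_connecting[OF ex, of "susp T p1 \<cdot> d" D] by auto
  note [simp] = k(1)[unfolded mem_Hom]
  have "susp T q2 \<cdot> (susp T F \<cdot> d) = \<O> D (susp_ob T N)" unfolding Fd by simp
  then have p2d: "susp T p2 \<cdot> d = \<O> D (susp_ob T N)" by (simp add: F_def susp_B)
  have "d = (susp T i1 \<cdot> (h \<cdot> k)) \<oplus> (susp T i2 \<cdot> (susp T p2 \<cdot> d))"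
    using biproduct_decomp_target[OF biproduct_susp[OF A], of d] by (simp add: k(2))
  then have dk: "d = d \<cdot> (w \<cdot> k)"
    unfolding p2d by (simp add: comp_eq_assoc[OF w(3)])
  have "d \<cdot> (\<I> D \<oplus> \<ominus> (w \<cdot> k)) = d \<oplus> \<ominus> (d \<cdot> (w \<cdot> k))" by simp
  then have "d \<cdot> (\<I> D \<oplus> \<ominus> (w \<cdot> k)) = \<O> D (susp_ob T A)"
    unfolding dk[symmetric] by simp
  then obtain l where l: "l \<in> Hom T D B" "\<I> D \<oplus> \<ominus> (w \<cdot> k) = c \<cdot> l"
    using exact_weak_kernel[OF exact_rotate[OF ex'], of "\<I> D \<oplus> \<ominus> (w \<cdot> k)" D] by auto
  note [simp] = l(1)[unfolded mem_Hom]
  \<comment> \<open>As \<open>c\<close> vanishes on \<open>N\<close>, the error term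
    \<open>c l\<close> factors through \<open>w\<close> too, which corrects \<open>k\<close> to a
    true section.\<close>
  have "c \<cdot> l = c \<cdot> ((j1 \<cdot> (q1 \<cdot> l)) \<oplus> (j2 \<cdot> (q2 \<cdot> l)))"
    by (simp only: biproduct_decomp_target[OF B] l(1)[unfolded mem_Hom])
  also have "\<dots> = w \<cdot> (g \<cdot> (q1 \<cdot> l))"
    by (simp add: comp_eq_assoc[OF cj2] comp_eq_assoc[OF w(2)])
  finally have cl: "c \<cdot> l = w \<cdot> (g \<cdot> (q1 \<cdot> l))" .
  have "w \<cdot> (k \<oplus> (g \<cdot> (q1 \<cdot> l))) = (w \<cdot> k) \<oplus> (\<I> D \<oplus> \<ominus> (w \<cdot> k))"
    unfolding l(2) cl by simp
  also have "\<dots> = \<I> D \<oplus> ((w \<cdot> k) \<oplus> \<ominus> (w \<cdot> k))" by (rule plus_left_comm) simp_all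
  also have "\<dots> = \<I> D" by simp
  finally have "is_iso T w"
    by (rule split_epi_mono_is_iso[OF w(1) _ _ mono, rotated]) simp_all
  then obtain v where v: "v \<in> Hom T D Z" "v \<cdot> w = \<I> Z" "w \<cdot> v = \<I> D"
    using is_isoE w(1) by metis
  note [simp] = v(1)[unfolded mem_Hom]
  have vwg: "v \<cdot> (w \<cdot> g) = g" by (simp add: comp_eq_assoc[OF v(2)])
  have vc: "v \<cdot> c = g \<cdot> q1"
    by (rule biproduct_ext_source[OF B, of _ Z]) (use vwg in \<open>simp_all add: w(2) cj2\<close>)
  have "exact T F (v \<cdot> c) (susp T i1 \<cdot> h)"
  proof (rule exact_iso[OF ex'])
    show "is_iso T v" using is_isoI[OF v(1) w(1) v(3,2)] .
    show "(susp T i1 \<cdot> h) \<cdot> v = d" unfolding w(3) by (simp add: v(3))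
  qed simp_all
  then show ?thesis by (simp add: vc F_def)
qed

text \<open>This adds the triangle \<open>0 \<rightarrow> N = N\<close>: rotate once, add the
  identity of \<open>N\<close> by the previous lemma, and rotate back.\<close>

lemma exact_sum_identity':
  assumes ex: "exact T f g h"
    and B: "biproduct T (tgt T f) N B j1 j2 q1 q2"
    and D: "biproduct T (tgt T g) N D k1 k2 r1 r2"
  shows "exact T (j1 \<cdot> f) ((k1 \<cdot> (g \<cdot> q1)) \<oplus> (k2 \<cdot> q2)) (h \<cdot> r1)"
proof -
  note [simp] = exact_simps[OF ex] biproduct_simps[OF B] biproduct_simps[OF D]
  have "exact T ((k1 \<cdot> (g \<cdot> q1)) \<oplus> (k2 \<cdot> q2)) (h \<cdot> r1) (susp T j1 \<cdot> \<ominus> susp T f)"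
    using exact_sum_identity[OF exact_rotate[OF ex], of N B j1 j2 q1 q2 D k1 k2 r1 r2] B D by simp
  then show ?thesis
    by (subst TR2_rotate) (auto intro!: candidate_triangleI[of _ "src T f" B _ D])
qed

section \<open>Pasting two homotopy cartesian squares\<close>

lemma differential_paste:
  assumes hom: "\<phi> \<in> Hom T X Y" "\<psi> \<in> Hom T Y Z" "\<phi>' \<in> Hom T X' Y'" "\<psi>' \<in> Hom T Y' Z'"
    "f \<in> Hom T X X'" "g \<in> Hom T Y Y'" "h \<in> Hom T Z Z'"
    and L: "differential T \<phi> f g \<phi>' \<delta>\<^sub>L"
    and R: "differential T \<psi> g h \<psi>' \<delta>\<^sub>R"
  obtains \<delta>\<^sub>P where "differential T (\<psi> \<cdot> \<phi>) f h (\<psi>' \<cdot> \<phi>') \<delta>\<^sub>P"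
    "susp T \<phi> \<cdot> \<delta>\<^sub>P = \<delta>\<^sub>R" "\<delta>\<^sub>P \<cdot> \<psi>' = \<delta>\<^sub>L"
proof -
  note [simp] = hom[unfolded mem_Hom]
  have ob [simp]: "X \<in> Ob T" "Y \<in> Ob T" "Z \<in> Ob T" "X' \<in> Ob T" "Y' \<in> Ob T" "Z' \<in> Ob T"
    using src_closed[of f] src_closed[of g] src_closed[of h] tgt_closed[of f] tgt_closed[of g]
      tgt_closed[of h] by simp_all
  have sqL: "g \<cdot> \<phi> = \<phi>' \<cdot> f" and sqR: "h \<cdot> \<psi> = \<psi>' \<cdot> g"
    using L R by (simp_all add: differential_def commutative_square_def)
  note sq = sqL sqR comp_eq_assoc[OF sqL] comp_eq_assoc[OF sqR]
  obtain BL iL jL pL qL where BL: "biproduct T X' Y BL iL jL pL qL"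
    and exL: "exact T ((iL \<cdot> f) \<oplus> (jL \<cdot> \<phi>)) ((\<phi>' \<cdot> pL) \<oplus> (\<ominus> g \<cdot> qL)) \<delta>\<^sub>L"
    using L by (auto simp: differential_def)
  obtain BR iR jR pR qR where BR: "biproduct T Y' Z BR iR jR pR qR"
    and exR: "exact T ((iR \<cdot> g) \<oplus> (jR \<cdot> \<psi>)) ((\<psi>' \<cdot> pR) \<oplus> (\<ominus> h \<cdot> qR)) \<delta>\<^sub>R"
    using R by (auto simp: differential_def)
  obtain D iD jD pD qD where D: "biproduct T X' Z D iD jD pD qD"
    using biproduct_exists by force
  note [simp] = biproduct_simps[OF BL] biproduct_simps[OF BR] biproduct_simps[OF D]
  obtain Q i j p q where Q: "biproduct T D Y' Q i j p q"
    using biproduct_exists by force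
  note [simp] = biproduct_simps[OF Q]
  define A where "A = (iL \<cdot> f) \<oplus> (jL \<cdot> \<phi>)"
  define uL where "uL = (\<phi>' \<cdot> pL) \<oplus> (\<ominus> g \<cdot> qL)"
  define uR where "uR = (\<psi>' \<cdot> pR) \<oplus> (\<ominus> h \<cdot> qR)"
  have [simp]: "A \<in> Ar T" "src T A = X" "tgt T A = BL"
    "uL \<in> Ar T" "src T uL = BL" "tgt T uL = Y'" "uR \<in> Ar T" "src T uR = BR" "tgt T uR = Z'"
    by (simp_all add: A_def uL_def uR_def)
  have exL: "exact T A uL \<delta>\<^sub>L" using exL by (simp only: A_def uL_def)
  have [simp]: "\<delta>\<^sub>L \<in> Ar T" "src T \<delta>\<^sub>L = Y'" "tgt T \<delta>\<^sub>L = susp_ob T X"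
    "\<delta>\<^sub>R \<in> Ar T" "src T \<delta>\<^sub>R = Z'" "tgt T \<delta>\<^sub>R = susp_ob T Y"
    using exact_simps[OF exL] exact_simps[OF exR] by simp_all

  text \<open>\<open>Q\<close> is \<open>X' \<oplus> Z \<oplus> Y'\<close>. Embedding \<open>X'\<close> by \<open>[1; 0; -\<phi>']\<close> instead of \<open>[1; 0; 0]\<close> makes
    \<open>1\<^bsub>X'\<^esub> \<oplus> [g; \<psi>]\<close> after \<open>A = [f; \<phi>]\<close> vanish in the component \<open>Y'\<close>.\<close>

  define \<alpha> where "\<alpha> = (j \<cdot> pR) \<oplus> (i \<cdot> (jD \<cdot> qR))"
  define \<beta> where "\<beta> = (i \<cdot> iD) \<oplus> \<ominus> (j \<cdot> \<phi>')"
  define \<gamma> where "\<gamma> = (iR \<cdot> (q \<oplus> (\<phi>' \<cdot> (pD \<cdot> p)))) \<oplus> (jR \<cdot> (qD \<cdot> p))"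
  define \<epsilon> where "\<epsilon> = pD \<cdot> p"
  have [simp]: "\<alpha> \<in> Ar T" "src T \<alpha> = BR" "tgt T \<alpha> = Q" "\<beta> \<in> Ar T" "src T \<beta> = X'" "tgt T \<beta> = Q"
    "\<gamma> \<in> Ar T" "src T \<gamma> = Q" "tgt T \<gamma> = BR" "\<epsilon> \<in> Ar T" "src T \<epsilon> = Q" "tgt T \<epsilon> = X'"
    by (simp_all add: \<alpha>_def \<beta>_def \<gamma>_def \<epsilon>_def)
  have BR_id: "(iR \<cdot> pR) \<oplus> (jR \<cdot> qR) = \<I> BR" and Q_id: "(i \<cdot> p) \<oplus> (j \<cdot> q) = \<I> Q"
    using BR Q by (simp_all add: biproduct_def)
  have p_split: "(i \<cdot> (iD \<cdot> (pD \<cdot> p))) \<oplus> (i \<cdot> (jD \<cdot> (qD \<cdot> p))) = i \<cdot> p"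
    using arg_cong[OF biproduct_decomp_target[OF D, of p], of "\<lambda>x. i \<cdot> x"] by simp
  \<comment> \<open>The summand \<open>\<phi>' pD p\<close> in \<open>\<gamma>\<close> cancels the
    twist in \<open>\<beta>\<close>, so the four maps form a second biproduct structure on
    \<open>Q\<close>, with summands \<open>BR\<close> and \<open>X'\<close>.\<close>
  have "(\<alpha> \<cdot> \<gamma>) \<oplus> (\<beta> \<cdot> \<epsilon>) =
      ((i \<cdot> (iD \<cdot> (pD \<cdot> p))) \<oplus> (i \<cdot> (jD \<cdot> (qD \<cdot> p)))) \<oplus> (j \<cdot> q)"
    by (simp add: \<alpha>_def \<beta>_def \<gamma>_def \<epsilon>_def plus_comm plus_left_comm)
  also have "\<dots> = \<I> Q" by (simp only: p_split Q_id)
  finally have twisted: "biproduct T BR X' Q \<alpha> \<beta> \<gamma> \<epsilon>"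
    unfolding biproduct_def using BR_id
    by (simp add: \<alpha>_def \<beta>_def \<gamma>_def \<epsilon>_def plus_comm plus_left_comm)

  define B where "B = (\<alpha> \<cdot> (((iR \<cdot> g) \<oplus> (jR \<cdot> \<psi>)) \<cdot> qL)) \<oplus> (\<beta> \<cdot> pL)"
  have [simp]: "B \<in> Ar T" "src T B = BL" "tgt T B = Q" by (simp_all add: B_def)
  \<comment> \<open>In the twisted coordinates, \<open>B\<close> is the first map of the right
    triangle plus the identity of \<open>X'\<close>; adding that identity leaves the cone
    \<open>Z'\<close> unchanged.\<close>
  have exB: "exact T B (uR \<cdot> \<gamma>) (susp T jL \<cdot> \<delta>\<^sub>R)"
    unfolding B_def uR_def
    by (rule exact_sum_identity[OF exR, where N = X' and A = BL and ?i2.0 = iL and B = Q and ?q2.0 = \<epsilon>]) (simp_all add: twisted biproduct_commute[OF BL])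

  \<comment> \<open>The column of the pasted rectangle; its cone \<open>W\<close> has to be
    identified with \<open>Z'\<close>.\<close>
  define a where "a = (iD \<cdot> f) \<oplus> (jD \<cdot> (\<psi> \<cdot> \<phi>))"
  have a [simp]: "a \<in> Ar T" "src T a = X" "tgt T a = D" by (simp_all add: a_def)
  obtain b c where exa: "exact T a b c" using TR1_complete[OF a(1)] by blast
  define W where "W = tgt T b"
  have [simp]: "b \<in> Ar T" "src T b = D" "tgt T b = W"
    "c \<in> Ar T" "src T c = W" "tgt T c = susp_ob T X"
    using exact_simps[OF exa] by (simp_all add: W_def)
  have [simp]: "W \<in> Ob T" using src_closed[of c] by simp
  obtain E e\<^sub>1 e\<^sub>2 r\<^sub>1 r\<^sub>2 where E: "biproduct T W Y' E e\<^sub>1 e\<^sub>2 r\<^sub>1 r\<^sub>2"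
    using biproduct_exists by force
  note [simp] = biproduct_simps[OF E]
  define w where "w = (e\<^sub>1 \<cdot> (b \<cdot> p)) \<oplus> (e\<^sub>2 \<cdot> q)"
  have [simp]: "w \<in> Ar T" "src T w = Q" "tgt T w = E" by (simp_all add: w_def)
  have "exact T (i \<cdot> a) w (c \<cdot> r\<^sub>1)"
    unfolding w_def by (rule exact_sum_identity'[OF exa, where N = Y' and B = Q and D = E and ?j2.0 = j and ?r2.0 = r\<^sub>2]) (simp_all add: Q E)
  moreover have BA: "B \<cdot> A = i \<cdot> a"
    by (simp add: B_def A_def \<alpha>_def \<beta>_def a_def sq plus_comm plus_left_comm)
  ultimately have exBA: "exact T (B \<cdot> A) w (c \<cdot> r\<^sub>1)" by simp
  obtain s t where s: "s \<in> Hom T Y' E" and t: "t \<in> Hom T E Z'"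
    and exst: "exact T s t (susp T uL \<cdot> (susp T jL \<cdot> \<delta>\<^sub>R))"
    and su: "s \<cdot> uL = w \<cdot> B" and cs: "(c \<cdot> r\<^sub>1) \<cdot> s = \<delta>\<^sub>L" and tw: "t \<cdot> w = uR \<cdot> \<gamma>"
    and \<delta>t: "(susp T jL \<cdot> \<delta>\<^sub>R) \<cdot> t = susp T A \<cdot> (c \<cdot> r\<^sub>1)"
    using TR4_octahedral[OF _ _ exL exB exBA, of X BL Q] by auto
  note [simp] = s[unfolded mem_Hom] t[unfolded mem_Hom]
  define s\<^sub>1 t\<^sub>1 where "s\<^sub>1 = r\<^sub>1 \<cdot> s" and "t\<^sub>1 = t \<cdot> e\<^sub>1"
  have [simp]: "s\<^sub>1 \<in> Ar T" "src T s\<^sub>1 = Y'" "tgt T s\<^sub>1 = W" "t\<^sub>1 \<in> Ar T" "src T t\<^sub>1 = W" "tgt T t\<^sub>1 = Z'"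
    by (simp_all add: s\<^sub>1_def t\<^sub>1_def)
  have cs\<^sub>1: "c \<cdot> s\<^sub>1 = \<delta>\<^sub>L" using cs by (simp add: s\<^sub>1_def)

  \<comment> \<open>Since \<open>r\<^sub>2 w = q\<close>, this is the \<open>Y'\<close> component of
    \<open>B\<close>: the column \<open>[g; \<psi>]\<close> contributes \<open>g\<close> and the
    twist \<open>- \<phi>'\<close>, in total \<open>- uL\<close>. So \<open>r\<^sub>2 s + 1\<close>
    kills \<open>uL\<close> and factors through \<delta>\<open>\<^sub>L\<close>.\<close>
  have "(r\<^sub>2 \<cdot> s) \<cdot> uL = r\<^sub>2 \<cdot> (w \<cdot> B)" by (simp add: su)
  also have "\<dots> = \<ominus> uL"
    by (simp add: w_def B_def uL_def \<alpha>_def \<beta>_def plus_comm)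
  finally have r2su: "(r\<^sub>2 \<cdot> s) \<cdot> uL = \<ominus> uL" .
  have "((r\<^sub>2 \<cdot> s) \<oplus> \<I> Y') \<cdot> uL = ((r\<^sub>2 \<cdot> s) \<cdot> uL) \<oplus> uL" by simp
  also have "\<dots> = \<O> BL Y'" unfolding r2su by simp
  finally obtain k where k: "k \<in> Hom T (susp_ob T X) Y'" "(r\<^sub>2 \<cdot> s) \<oplus> \<I> Y' = k \<cdot> \<delta>\<^sub>L"
    using exact_weak_cokernel[OF exact_rotate[OF exL], of "(r\<^sub>2 \<cdot> s) \<oplus> \<I> Y'" Y'] by auto
  note [simp] = k(1)[unfolded mem_Hom]
  have "r\<^sub>2 \<cdot> s = ((r\<^sub>2 \<cdot> s) \<oplus> \<I> Y') \<oplus> \<ominus> \<I> Y'" by simp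
  then have r2s: "r\<^sub>2 \<cdot> s = (k \<cdot> \<delta>\<^sub>L) \<oplus> \<ominus> \<I> Y'" by (simp only: k(2))

  have "t \<cdot> e\<^sub>2 = (t \<cdot> w) \<cdot> j" by (simp add: w_def)
  also have "\<dots> = \<psi>'" unfolding tw by (simp add: uR_def \<gamma>_def)
  finally have te\<^sub>2: "t \<cdot> e\<^sub>2 = \<psi>'" .
  have t_eq: "t \<cdot> x = (t\<^sub>1 \<cdot> (r\<^sub>1 \<cdot> x)) \<oplus> (\<psi>' \<cdot> (r\<^sub>2 \<cdot> x))" if "x \<in> Ar T" "tgt T x = E" for x
    using arg_cong[OF biproduct_decomp_target[OF E that], of "\<lambda>y. t \<cdot> y"] that
    by (simp add: t\<^sub>1_def comp_eq_assoc[OF te\<^sub>2])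
  \<comment> \<open>The right side is the row of the pasted rectangle, read off from
    \<open>w i = e\<^sub>1 b\<close>.\<close>
  have t\<^sub>1b: "t\<^sub>1 \<cdot> b = ((\<psi>' \<cdot> \<phi>') \<cdot> pD) \<oplus> (\<ominus> h \<cdot> qD)"
  proof -
    have "t\<^sub>1 \<cdot> b = (t \<cdot> w) \<cdot> i" by (simp add: w_def t\<^sub>1_def)
    also have "\<dots> = ((\<psi>' \<cdot> \<phi>') \<cdot> pD) \<oplus> (\<ominus> h \<cdot> qD)" unfolding tw by (simp add: uR_def \<gamma>_def)
    finally show ?thesis .
  qed

  text \<open>\<open>t\<^sub>1\<close> need not satisfy \<open>t\<^sub>1 s\<^sub>1 = \<psi>'\<close>; the correction by \<open>\<psi>' k c\<close> cancels the error \<open>k \<delta>\<^sub>L\<close> in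
    \<open>r\<^sub>2 s\<close>, and it changes neither \<open>t\<^sub>1 b\<close> (as \<open>c b = 0\<close>) nor \<open>\<delta>\<^sub>R t\<^sub>1\<close> (as \<open>\<delta>\<^sub>R \<psi>' = 0\<close>).\<close>

  define \<tau> where "\<tau> = t\<^sub>1 \<oplus> (\<psi>' \<cdot> (k \<cdot> c))"
  have [simp]: "\<tau> \<in> Ar T" "src T \<tau> = W" "tgt T \<tau> = Z'" by (simp_all add: \<tau>_def)
  have cb: "c \<cdot> b = \<O> D (susp_ob T X)" using exact_comp_zero(2)[OF exa] by simp
  have \<tau>b: "\<tau> \<cdot> b = ((\<psi>' \<cdot> \<phi>') \<cdot> pD) \<oplus> (\<ominus> h \<cdot> qD)"
    by (simp add: \<tau>_def t\<^sub>1b cb)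
  \<comment> \<open>The error \<open>\<psi>' k \<delta>\<^sub>L\<close> from
    \<open>r\<^sub>2 s\<close> is exactly what the correction in \<open>\<tau>\<close> contributes
    on \<open>s\<^sub>1\<close>, because \<open>c s\<^sub>1 = \<delta>\<^sub>L\<close>.\<close>
  have "t \<cdot> s = (\<tau> \<cdot> s\<^sub>1) \<oplus> \<ominus> \<psi>'"
    by (simp add: t_eq r2s \<tau>_def cs\<^sub>1 flip: s\<^sub>1_def)
  then have "(\<tau> \<cdot> s\<^sub>1) \<oplus> \<ominus> \<psi>' = \<O> Y' Z'" using exact_comp_zero(1)[OF exst] by simp
  from plus_neg_eq_zero_imp_eq[OF _ _ this] have \<tau>s\<^sub>1: "\<tau> \<cdot> s\<^sub>1 = \<psi>'" by simp

  have "\<delta>\<^sub>R \<cdot> uR = \<O> BR (susp_ob T Y)"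
    using exact_comp_zero(2)[OF exR] by (simp add: uR_def)
  then have "(\<delta>\<^sub>R \<cdot> uR) \<cdot> iR = \<O> Y' (susp_ob T Y)" by (simp del: comp_assoc)
  then have \<delta>\<psi>': "\<delta>\<^sub>R \<cdot> \<psi>' = \<O> Y' (susp_ob T Y)" by (simp add: uR_def)
  note susp_BL = biproduct_simps(16-)[OF biproduct_susp[OF BL]]
  \<comment> \<open>Projecting the last octahedral relation to \<open>\<Sigma> Y\<close> and
    restricting it to \<open>W\<close> isolates the entry \<open>\<phi>\<close> of
    \<open>A\<close>.\<close>
  have "susp T qL \<cdot> (((susp T jL \<cdot> \<delta>\<^sub>R) \<cdot> t) \<cdot> e\<^sub>1) = susp T qL \<cdot> ((susp T A \<cdot> (c \<cdot> r\<^sub>1)) \<cdot> e\<^sub>1)"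
    by (simp only: \<delta>t)
  then have "\<delta>\<^sub>R \<cdot> t\<^sub>1 = susp T \<phi> \<cdot> c"
    by (simp add: A_def t\<^sub>1_def susp_BL)
  then have \<delta>\<tau>: "\<delta>\<^sub>R \<cdot> \<tau> = susp T \<phi> \<cdot> c"
    by (simp add: \<tau>_def comp_eq_assoc[OF \<delta>\<psi>'])

  have mono: "x = \<O> W W" if x: "x \<in> Hom T W W" and \<tau>x: "\<tau> \<cdot> x = \<O> W Z'" for x
  proof -
    note [simp] = x[unfolded mem_Hom]
    \<comment> \<open>The second entry is chosen so that \<open>t z = \<tau> x = 0\<close>. With
      \<open>z = s y\<close>, comparing the entries in \<open>Y'\<close> gives
      \<open>k \<delta>\<^sub>L y = k \<delta>\<^sub>L y - y\<close>, hence
      \<open>y = 0\<close>.\<close>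
    define z where "z = (e\<^sub>1 \<cdot> x) \<oplus> (e\<^sub>2 \<cdot> (k \<cdot> (c \<cdot> x)))"
    have z: "z \<in> Hom T W E" by (simp add: z_def)
    have "t \<cdot> z = \<tau> \<cdot> x" by (simp add: t_eq z_def \<tau>_def)
    then obtain y where y: "y \<in> Hom T W Y'" "z = s \<cdot> y"
      using exact_weak_kernel[OF exst, of z W] z \<tau>x by auto
    note [simp] = y(1)[unfolded mem_Hom]
    have "r\<^sub>1 \<cdot> z = r\<^sub>1 \<cdot> (s \<cdot> y)" "r\<^sub>2 \<cdot> z = r\<^sub>2 \<cdot> (s \<cdot> y)" by (simp_all only: y(2))
    then have xy: "x = s\<^sub>1 \<cdot> y" and "k \<cdot> (c \<cdot> x) = (r\<^sub>2 \<cdot> s) \<cdot> y" by (simp_all add: z_def s\<^sub>1_def)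
    then have "k \<cdot> (\<delta>\<^sub>L \<cdot> y) = (k \<cdot> (\<delta>\<^sub>L \<cdot> y)) \<oplus> \<ominus> y"
      by (simp add: r2s comp_eq_assoc[OF cs\<^sub>1])
    then have "\<ominus> (k \<cdot> (\<delta>\<^sub>L \<cdot> y)) \<oplus> (k \<cdot> (\<delta>\<^sub>L \<cdot> y)) =
        \<ominus> (k \<cdot> (\<delta>\<^sub>L \<cdot> y)) \<oplus> ((k \<cdot> (\<delta>\<^sub>L \<cdot> y)) \<oplus> \<ominus> y)"
      by (rule arg_cong)
    then have "\<O> W Y' = \<ominus> y" by simp
    also have "\<O> W Y' = \<ominus> \<O> W Y'" by simp
    finally have "\<O> W Y' = y" by (rule neg_eq_imp_eq) simp_all
    then have "y = \<O> W Y'" by (rule sym)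
    then show ?thesis by (simp add: xy)
  qed

  \<comment> \<open>A retraction of \<open>s\<close>. As \<open>\<Sigma> s\<close> kills the
    connecting map \<open>\<omega>\<close> of the octahedral triangle, \<open>\<omega>\<close>
    vanishes and \<open>t\<close> has a section \<open>m\<close>.\<close>
  define \<rho> where "\<rho> = (k \<cdot> (c \<cdot> r\<^sub>1)) \<oplus> \<ominus> r\<^sub>2"
  have [simp]: "\<rho> \<in> Ar T" "src T \<rho> = E" "tgt T \<rho> = Y'" by (simp_all add: \<rho>_def)
  have "\<rho> \<cdot> s = \<I> Y'" by (simp add: \<rho>_def r2s cs\<^sub>1 flip: s\<^sub>1_def)
  then have \<rho>s: "susp T \<rho> \<cdot> susp T s = \<I> (susp_ob T Y')" by (simp flip: susp_simps(6))
  define \<omega> where "\<omega> = susp T uL \<cdot> (susp T jL \<cdot> \<delta>\<^sub>R)"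
  have [simp]: "\<omega> \<in> Ar T" "src T \<omega> = Z'" "tgt T \<omega> = susp_ob T Y'" by (simp_all add: \<omega>_def)
  have exst: "exact T s t \<omega>" using exst by (simp only: \<omega>_def)
  have "susp T \<rho> \<cdot> (susp T s \<cdot> \<omega>) = \<O> Z' (susp_ob T Y')"
    using exact_comp_zero(3)[OF exst] by simp
  then have "\<omega> = \<O> Z' (susp_ob T Y')" by (simp add: comp_eq_assoc[OF \<rho>s])
  then obtain m where m: "m \<in> Hom T Z' E" "\<I> Z' = t \<cdot> m"
    using exact_weak_kernel[OF exact_rotate[OF exst], of "\<I> Z'" Z'] by auto
  note [simp] = m(1)[unfolded mem_Hom]
  \<comment> \<open>From \<open>\<tau> s\<^sub>1 = \<psi>'\<close> one gets
    \<open>t = \<tau> (r\<^sub>1 - s\<^sub>1 \<rho>)\<close>; here \<open>n\<close> is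
    \<open>(r\<^sub>1 - s\<^sub>1 \<rho>) m\<close> written out.\<close>
  define n where "n = ((r\<^sub>1 \<cdot> m) \<oplus> \<ominus> (s\<^sub>1 \<cdot> (k \<cdot> (c \<cdot> (r\<^sub>1 \<cdot> m))))) \<oplus> (s\<^sub>1 \<cdot> (r\<^sub>2 \<cdot> m))"
  have n: "n \<in> Hom T Z' W" by (simp add: n_def)
  have "\<tau> \<cdot> n = ((\<tau> \<cdot> (r\<^sub>1 \<cdot> m)) \<oplus> \<ominus> (\<psi>' \<cdot> (k \<cdot> (c \<cdot> (r\<^sub>1 \<cdot> m))))) \<oplus> (\<psi>' \<cdot> (r\<^sub>2 \<cdot> m))"
    by (simp add: n_def comp_eq_assoc[OF \<tau>s\<^sub>1])
  also have "\<dots> = t \<cdot> m" by (simp add: t_eq \<tau>_def)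
  finally have \<tau>n: "\<tau> \<cdot> n = \<I> Z'" by (simp add: m(2))
  have \<tau>_hom: "\<tau> \<in> Hom T W Z'" by simp
  have iso: "is_iso T \<tau>" by (rule split_epi_mono_is_iso[OF \<tau>_hom n \<tau>n mono])
  then obtain \<sigma> where \<sigma>: "\<sigma> \<in> Hom T Z' W" "\<sigma> \<cdot> \<tau> = \<I> W" "\<tau> \<cdot> \<sigma> = \<I> Z'"
    using is_isoE[OF _ \<tau>_hom] by blast
  note [simp] = \<sigma>(1)[unfolded mem_Hom]

  show ?thesis
  proof (rule that)
    \<comment> \<open>Transport along \<open>\<tau>\<close> replaces \<open>W\<close> by
      \<open>Z'\<close> and \<open>b\<close> by the row of the rectangle, and makes
      \<open>c \<sigma>\<close> the differential.\<close>
    have "exact T a (\<tau> \<cdot> b) (c \<cdot> \<sigma>)"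
      by (rule exact_iso[OF exa _ iso]) (simp_all add: \<sigma>(2))
    then have "\<exists>B \<iota>\<^sub>1 \<iota>\<^sub>2 \<pi>\<^sub>1 \<pi>\<^sub>2. biproduct T X' Z B \<iota>\<^sub>1 \<iota>\<^sub>2 \<pi>\<^sub>1 \<pi>\<^sub>2 \<and>
        exact T ((\<iota>\<^sub>1 \<cdot> f) \<oplus> (\<iota>\<^sub>2 \<cdot> (\<psi> \<cdot> \<phi>))) (((\<psi>' \<cdot> \<phi>') \<cdot> \<pi>\<^sub>1) \<oplus> (\<ominus> h \<cdot> \<pi>\<^sub>2)) (c \<cdot> \<sigma>)"
      unfolding \<tau>b a_def using D by blast
    moreover have "commutative_square T (\<psi> \<cdot> \<phi>) f h (\<psi>' \<cdot> \<phi>')"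
      by (simp add: commutative_square_def sq)
    ultimately show "differential T (\<psi> \<cdot> \<phi>) f h (\<psi>' \<cdot> \<phi>') (c \<cdot> \<sigma>)"
      by (simp add: differential_def del: comp_assoc comp_neg)
    have "(\<delta>\<^sub>R \<cdot> \<tau>) \<cdot> \<sigma> = \<delta>\<^sub>R" by (simp add: \<sigma>(3))
    then show "susp T \<phi> \<cdot> (c \<cdot> \<sigma>) = \<delta>\<^sub>R" unfolding \<delta>\<tau> by simp
    have "\<sigma> \<cdot> \<psi>' = s\<^sub>1" unfolding \<tau>s\<^sub>1[symmetric] by (simp add: comp_eq_assoc[OF \<sigma>(2)])
    then show "(c \<cdot> \<sigma>) \<cdot> \<psi>' = \<delta>\<^sub>L" by (simp add: cs\<^sub>1)
  qed
qed

end

theorem proposition6p11: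
  fixes T :: "('o, 'm, 'z) triangulated_scheme" (structure)
    and X Y Z X' Y' Z' :: 'o
    and \<phi> \<psi> \<phi>' \<psi>' f g h :: 'm
  assumes "triangulated_category T"
    and "\<phi> \<in> Hom T X Y" and "\<psi> \<in> Hom T Y Z"
    and "\<phi>' \<in> Hom T X' Y'" and "\<psi>' \<in> Hom T Y' Z'"
    and "f \<in> Hom T X X'" and "g \<in> Hom T Y Y'" and "h \<in> Hom T Z Z'"
    and "g \<cdot> \<phi> = \<phi>' \<cdot> f" and "h \<cdot> \<psi> = \<psi>' \<cdot> g"
    and "homotopy_cartesian T \<phi> f g \<phi>'"
    and "homotopy_cartesian T \<psi> g h \<psi>'"
  shows "homotopy_cartesian T (\<psi> \<cdot> \<phi>) f h (\<psi>' \<cdot> \<phi>') \<and>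
    (\<forall>\<delta>\<^sub>L \<delta>\<^sub>R. differential T \<phi> f g \<phi>' \<delta>\<^sub>L \<and> differential T \<psi> g h \<psi>' \<delta>\<^sub>R \<longrightarrow>
      (\<exists>\<delta>\<^sub>P. differential T (\<psi> \<cdot> \<phi>) f h (\<psi>' \<cdot> \<phi>') \<delta>\<^sub>P \<and>
        susp T \<phi> \<cdot> \<delta>\<^sub>P = \<delta>\<^sub>R \<and> \<delta>\<^sub>P \<cdot> \<psi>' = \<delta>\<^sub>L))"
proof -
  interpret triangulated_category T by fact
  have paste: "\<exists>\<delta>\<^sub>P. differential T (\<psi> \<cdot> \<phi>) f h (\<psi>' \<cdot> \<phi>') \<delta>\<^sub>P \<and>
      susp T \<phi> \<cdot> \<delta>\<^sub>P = \<delta>\<^sub>R \<and> \<delta>\<^sub>P \<cdot> \<psi>' = \<delta>\<^sub>L"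
    if "differential T \<phi> f g \<phi>' \<delta>\<^sub>L" "differential T \<psi> g h \<psi>' \<delta>\<^sub>R" for \<delta>\<^sub>L \<delta>\<^sub>R
    using differential_paste[OF assms(2-8) that] by blast
  \<comment> \<open>A square is homotopy cartesian when it has some differential, so the first claim
    follows by pasting any chosen pair of them.\<close>
  then show ?thesis
    using assms(11,12) unfolding homotopy_cartesian_def by blast
qed

end
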